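(* Let $q$ be a prime power, let $P\mathcal{U}_3\subset\mathbb{P}^4$ be a degenerate Hermitian threefold of rank $4$ over $\mathbb{F}_{q^2}$ with vertex $P$, and let $V(F)$ be an $\mathbb{F}_{q^2}$-threefold of degree $d$ in $\mathbb{P}^4$, $1\le d\le q-1$. Then $|(P\mathcal{U}_3\cap V(F))(\mathbb{F}_{q^2})|=1+q^2M_3(d)$ if and only if $(P\mathcal{U}_3\cap V(F))(\mathbb{F}_{q^2})$ is the union of (the sets of $\mathbb{F}_{q^2}$-points of) $M_3(d)$ distinct $\mathbb{F}_{q^2}$-lines of the cone $P\mathcal{U}_3$, each passing through $P$.
   Context: $\mathbb{P}^n$ is projective $n$-space over $\overline{\mathbb{F}}_q$, and $X(\mathbb{F}_{q^2})$ is the set of $\mathbb{F}_{q^2}$-rational points of $X$. An $\mathbb{F}_{q^2}$-hypersurface (surface if $n=3$, threefold if $n=4$) of degree $d$ in $\mathbb{P}^n$ is the zero set $V(F)$ of a nonzero homogeneous $F\in\mathbb{F}_{q^2}[x_0,\dots,x_n]$ of degree $d$ (not necessarily irreducible or reduced). The Hermitian variety of a nonzero $(n+1)\times(n+1)$ matrix $H=(h_{ij})$ over $\mathbb{F}_{q^2}$ with $h_{ij}=h_{ji}^q$ is the zero set of $\sum_{i,j}h_{ij}x_ix_j^q$ in $\mathbb{P}^n$; its rank is that of $H$, and it is non-degenerate if the rank is $n+1$ (notation $\mathcal{U}_n$, unique up to $\mathbb{F}_{q^2}$-projective equivalence). A Hermitian threefold of rank $4$ in $\mathbb{P}^4$ is,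 up to an $\mathbb{F}_{q^2}$-linear change of coordinates, $V(x_0^{q+1}+x_1^{q+1}+x_2^{q+1}+x_3^{q+1})$, a cone with vertex an $\mathbb{F}_{q^2}$-point $P$ (here $P=[0:0:0:0:1]$), denoted $P\mathcal{U}_3$. $M_3(d):=\max_{V(G)}|(\mathcal{U}_3\cap V(G))(\mathbb{F}_{q^2})|$ over all $\mathbb{F}_{q^2}$-surfaces $V(G)$ of degree $d$ in $\mathbb{P}^3$, where $\mathcal{U}_3$ is a non-degenerate Hermitian surface in $\mathbb{P}^3$; it is known that $M_3(d)=d(q^3+q^2-q)+q+1$ for $d\le q$. *)

theory Defs
  imports
    "HOL-Analysis.Analysis"
    "HOL-Algebra.Algebraic_Closure_Type"
    "HOL-Library.Poly_Mapping"
    "HOL-Number_Theory.Prime_Powers"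
begin

text \<open>
  Throughout, \<open>'a\<close> is the base field (later the field with \<open>q\<^sup>2\<close> elements), \<open>'a alg_closure\<close> its
  algebraic closure, and the type \<open>'n\<close> indexes the homogeneous coordinates, so the ambient
  projective space has dimension \<open>CARD('n) - 1\<close>. A projective point is the one-dimensional
  subspace of its representatives (including the zero vector).
\<close>

type_synonym ('a, 'n) point = "('a alg_closure ^ 'n) set"

definition proj_space :: "('a::field, 'n::finite) point set" where
  "proj_space = {vec.span {v} |v. v \<noteq> 0}"

definition rational_point :: "('a::field, 'n::finite) point \<Rightarrow> bool" where
  "rational_point P \<longleftrightarrow> (\<exists>v :: 'a ^ 'n. v \<noteq> 0 \<and> P = vec.span {\<chi> i. to_ac (v $ i)})"

definition rational_points :: "('a::field, 'n::finite) point set \<Rightarrow> ('a, 'n) point set" where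
  "rational_points V = {P \<in> V. rational_point P}"

definition proj_line :: "('a::field, 'n::finite) point \<Rightarrow> ('a, 'n) point \<Rightarrow> ('a, 'n) point set" where
  "proj_line P Q = {R \<in> proj_space. R \<subseteq> vec.span (P \<union> Q)}"

definition rational_line :: "('a::field, 'n::finite) point set \<Rightarrow> bool" where
  "rational_line l \<longleftrightarrow>
     (\<exists>P Q. rational_point P \<and> rational_point Q \<and> P \<noteq> Q \<and> l = proj_line P Q)"

text \<open>Polynomials in variables indexed by \<open>'n\<close>: maps from exponent vectors to coefficients.\<close>

type_synonym ('a, 'n) mpoly = "('n \<Rightarrow>\<^sub>0 nat) \<Rightarrow>\<^sub>0 'a"

definition homogeneous :: "nat \<Rightarrow> ('a::field, 'n::finite) mpoly \<Rightarrow> bool" where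
  "homogeneous d F \<longleftrightarrow>
     (\<forall>m \<in> Poly_Mapping.keys F. (\<Sum>i\<in>UNIV. Poly_Mapping.lookup m i) = d)"

definition poly_eval :: "('a::field, 'n::finite) mpoly \<Rightarrow> 'a alg_closure ^ 'n \<Rightarrow> 'a alg_closure" where
  "poly_eval F x =
     (\<Sum>m\<in>Poly_Mapping.keys F. to_ac (Poly_Mapping.lookup F m) *
        (\<Prod>i\<in>UNIV. (x $ i) ^ Poly_Mapping.lookup m i))"

definition zero_set :: "('a::field, 'n::finite) mpoly \<Rightarrow> ('a, 'n) point set" where
  "zero_set F = {P \<in> proj_space. \<forall>x\<in>P. poly_eval F x = 0}"

definition hermitian_matrix :: "nat \<Rightarrow> 'a::field ^ 'n::finite ^ 'n \<Rightarrow> bool" where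
  "hermitian_matrix q H \<longleftrightarrow> H \<noteq> 0 \<and> (\<forall>i j. H $ i $ j = (H $ j $ i) ^ q)"

definition hermitian_variety :: "nat \<Rightarrow> 'a::field ^ 'n::finite ^ 'n \<Rightarrow> ('a, 'n) point set" where
  "hermitian_variety q H =
     {P \<in> proj_space. \<forall>x\<in>P. (\<Sum>i\<in>UNIV. \<Sum>j\<in>UNIV. to_ac (H $ i $ j) * x $ i * (x $ j) ^ q) = 0}"

definition cone_vertex :: "('a::field, 'n::finite) point set \<Rightarrow> ('a, 'n) point \<Rightarrow> bool" where
  "cone_vertex V P \<longleftrightarrow> P \<in> V \<and> (\<forall>Q\<in>V. Q \<noteq> P \<longrightarrow> proj_line P Q \<subseteq> V)"

text \<open>
  For a non-degenerate Hermitian \<open>U\<close> this is the number \<open>M\<^sub>3(d)\<close>; it does not depend on the choice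
  of \<open>U\<close>, as any two such surfaces are projectively equivalent over the base field.
\<close>

definition M3 :: "nat \<Rightarrow> 'a::{field,finite} ^ 4 ^ 4 \<Rightarrow> nat \<Rightarrow> nat" where
  "M3 q U d = Max {card (rational_points (hermitian_variety q U \<inter> zero_set G)) |G.
                     G \<noteq> 0 \<and> homogeneous d G}"

end

theory Submission
  imports Defs "HOL-Number_Theory.Residues"
begin

text \<open>
  Write \<open>f(u + t p) = \<Sum>\<^sub>j t\<^sup>j g\<^sub>j(u)\<close> for a vertex vector \<open>p\<close> and \<open>u\<close> in a complement carrying a form isometric to
  \<open>U\<close>, and let \<open>g\<^sub>k\<close> be the top nonzero coefficient, of degree \<open>e = d - k\<close>. If \<open>k = 0\<close>, the intersection is
  the cone over the zeros of \<open>g\<^sub>0\<close> on \<open>U\<close>, a union of lines through the vertex. If \<open>k > 0\<close>, a line of the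
  cone over a point with \<open>g\<^sub>k \<noteq> 0\<close> has at most \<open>k\<close> points of \<open>V(F)\<close> besides the vertex, so the count is at most
  \<open>1 + q\<^sup>2 s + k m\<close>, where \<open>s\<close> and \<open>m\<close> count the points of \<open>U\<close> on which \<open>g\<^sub>k\<close> does and does not vanish.
  This is strictly below \<open>1 + q\<^sup>2 M\<^sub>3(d)\<close>, and the value of \<open>M\<^sub>3\<close> is not needed to see this: take a
  generator of \<open>U\<close> not contained in \<open>V(g\<^sub>k)\<close> and multiply \<open>g\<^sub>k\<close> by the equations of \<open>k\<close> planes through that
  generator, chosen among all \<open>q\<^sup>2 + 1\<close> to cover at least the average number of missing points of \<open>U\<close>.
\<close>

text \<open>The obstacle is that averaging alone just fails. It gives k planes that cover the share
  k / (q^2 + 1) of the m missing points, worth q^2 * k * m / (q^2 + 1), slightly less than the k * m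
  to be beaten. A common generator makes up the deficit: the planes partition the missing points off
  the generator, while those on the generator lie in every plane and are gained in full. There are
  many of these, because a form of degree e that is nonzero at some point of a line has at most e
  zeros among the remaining points of the line. The bound d <= q - 1 makes it possible to work with
  values only: a nonzero polynomial of such a degree is nonzero as a function, products of the forms
  that occur stay nonzero, and a form cannot vanish on all isotropic vectors, as there are lines
  with q of them. Hence polynomials become functions on base field vectors, and each point is
  counted through its q^2 - 1 representatives.\<close>

unbundle no fps_syntax

section \<open>Fields of square order and forms\<close>

lemma power_card_eq_same:
  fixes x :: "'a::{field,finite}"
  shows "x ^ CARD('a) = x"
proof (cases "x = 0")
  case False
  have "x * (\<Prod>y\<in>UNIV-{0}. x * y) = x * x ^ (CARD('a) - 1) * \<Prod>(UNIV-{0})"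
    by (simp add: prod.distrib mult_ac)
  also have "x * x ^ (CARD('a) - 1) = x ^ CARD('a)"
    using power_Suc[of x "CARD('a) - 1"] by simp
  also have "(\<Prod>y\<in>UNIV-{0}. x * y) = (\<Prod>y\<in>UNIV-{0}. y)"
    by (rule prod.reindex_bij_witness[of _ "\<lambda>y. y / x" "\<lambda>y. x * y"]) (use False in auto)
  finally show ?thesis
    by simp
qed simp

lemma card_le_fibres:
  assumes "finite A" "\<And>y. y \<in> f ` A \<Longrightarrow> card {x \<in> A. f x = y} \<le> n"
  shows "card A \<le> n * card (f ` A)"
proof -
  have "card A = (\<Sum>y\<in>f ` A. card {x \<in> A. f x = y})"
    using sum.image_gen[OF assms(1), of "\<lambda>_. 1::nat" f] by simp
  also have "\<dots> \<le> (\<Sum>y\<in>f ` A. n)"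
    by (intro sum_mono assms)
  finally show ?thesis by (simp add: mult.commute)
qed

lemma card_fibres_eq:
  assumes "finite A" "\<And>y. y \<in> f ` A \<Longrightarrow> card {x \<in> A. f x = y} = n"
  shows "card A = n * card (f ` A)"
proof -
  have "card A = (\<Sum>y\<in>f ` A. card {x \<in> A. f x = y})"
    using sum.image_gen[OF assms(1), of "\<lambda>_. 1::nat" f] by simp
  also have "\<dots> = (\<Sum>y\<in>f ` A. n)"
    by (intro sum.cong assms) auto
  finally show ?thesis by (simp add: mult.commute)
qed

text \<open>Small fibres force a large image. Surjectivity of trace and norm follows from this
  without exhibiting preimages, since their fibres are root sets of polynomials.\<close>

lemma image_eq_if_card_fibres_le:
  assumes "finite A" "f ` A \<subseteq> B" "finite B" "n > 0"
    and "\<And>y. y \<in> B \<Longrightarrow> card {x \<in> A. f x = y} \<le> n"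
    and "n * card B \<le> card A"
  shows "f ` A = B"
proof -
  have "card A \<le> n * card (f ` A)"
    using assms by (intro card_le_fibres) auto
  with assms(6) have "n * card B \<le> n * card (f ` A)" by linarith
  with assms(4) have "card B \<le> card (f ` A)" by simp
  with assms show ?thesis by (metis card_seteq)
qed

lemma poly_roots_card_le:
  fixes p :: "'a::{idom,finite} poly"
  assumes "p \<noteq> 0" "Polynomial.degree p \<le> n"
  shows "card {x. poly p x = 0} \<le> n"
  using card_poly_roots_bound[OF assms(1)] assms(2) by simp

section \<open>Homogeneous polynomial functions\<close>

text \<open>Functions rather than formal polynomials, because only values are counted; induction
  replaces the handling of exponents. Over a finite field the function does not determine the
  degree, and zero is a form of every degree.\<close>

inductive form :: "nat \<Rightarrow> ('a::comm_ring_1 ^ 'n::finite \<Rightarrow> 'a) \<Rightarrow> bool" where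
  const: "form 0 (\<lambda>x. c)"
| add: "form d f \<Longrightarrow> form d g \<Longrightarrow> form d (\<lambda>x. f x + g x)"
| coord: "form d f \<Longrightarrow> form (Suc d) (\<lambda>x. x $ i * f x)"

lemma form_scale: "form d f \<Longrightarrow> form d (\<lambda>x. c * f x)"
proof (induction rule: form.induct)
  case (coord d f i)
  from form.coord[OF coord.IH, of i] show ?case by (simp add: mult.left_commute)
qed (auto intro: form.intros simp: distrib_left)

lemma form_zero: "form d (\<lambda>x. 0)"
proof (induction d)
  case (Suc d)
  from form.coord[OF Suc] show ?case by simp
qed (rule form.const)

lemma form_sum: "(\<And>i. i \<in> I \<Longrightarrow> form d (f i)) \<Longrightarrow> form d (\<lambda>x. \<Sum>i\<in>I. f i x)"
  by (induction I rule: infinite_finite_induct) (auto intro: form_zero form.add)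

lemma form_coordinate: "form 1 (\<lambda>x. x $ i)"
  using form.coord[OF form.const[of 1], of i] by simp

lemma form_mult: "form a f \<Longrightarrow> form b g \<Longrightarrow> form (a + b) (\<lambda>x. f x * g x)"
proof (induction rule: form.induct)
  case (const c)
  then show ?case by (simp add: form_scale)
next
  case (add d f g')
  then show ?case by (simp add: distrib_right form.add)
next
  case (coord d f i)
  from form.coord[OF coord.IH[OF coord.prems], of i] show ?case by (simp add: mult.assoc)
qed

lemma form_power: "form 1 f \<Longrightarrow> form n (\<lambda>x. f x ^ n)"
proof (induction n)
  case (Suc n)
  from form_mult[OF Suc.prems Suc.IH[OF Suc.prems]] show ?case by simp
qed (simp add: form.const)

lemma form_homogeneous: "form d f \<Longrightarrow> f (c *s x) = c ^ d * f x"
  by (induction rule: form.induct) (auto simp: algebra_simps)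

text \<open>Each new coordinate factor is \<open>(A *v u) $ i + t * p $ i\<close>: the first summand
  keeps the power of t, the second raises it by one. With \<open>A = mat 1\<close> this describes f
  on a line; with \<open>p\<close> the vertex it separates the powers of the vertex
  coordinate.\<close>

lemma form_expand:
  fixes A :: "'a::comm_ring_1 ^ 'm::finite ^ 'n::finite"
  assumes "form d f"
  shows "\<exists>g. (\<forall>j\<le>d. form (d - j) (g j)) \<and> (\<forall>u t. f (A *v u + t *s p) = (\<Sum>j\<le>d. t ^ j * g j u))"
  using assms
proof (induction rule: form.induct)
  case (const c)
  show ?case by (intro exI[of _ "\<lambda>j u. c"]) (auto intro: form.const)
next
  case (add d f1 f2)
  then obtain g1 g2 where "\<forall>j\<le>d. form (d - j) (g1 j)" "\<forall>u t. f1 (A *v u + t *s p) = (\<Sum>j\<le>d. t ^ j * g1 j u)"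
    "\<forall>j\<le>d. form (d - j) (g2 j)" "\<forall>u t. f2 (A *v u + t *s p) = (\<Sum>j\<le>d. t ^ j * g2 j u)"
    by blast
  then show ?case
    by (intro exI[of _ "\<lambda>j u. g1 j u + g2 j u"]) (auto intro: form.add simp: sum.distrib distrib_left)
next
  case (coord d f i)
  then obtain g where g: "\<And>j. j \<le> d \<Longrightarrow> form (d - j) (g j)"
    "\<And>u t. f (A *v u + t *s p) = (\<Sum>j\<le>d. t ^ j * g j u)"
    by blast
  \<comment> \<open>Nothing is known of \<open>g\<close> beyond index \<open>d\<close>, and no index
    precedes 0; the two guards set these contributions to zero.\<close>
  define h where "h j u = (if j \<le> d then (A *v u) $ i * g j u else 0) +
    (if j = 0 then 0 else p $ i * g (j - 1) u)" for j u
  have lin: "form 1 (\<lambda>x. (A *v x) $ i)"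
    unfolding matrix_vector_mult_def using form_coordinate by (auto intro!: form_sum form_scale)
  have "form (Suc d - j) (h j)" if "j \<le> Suc d" for j
  proof -
    have 1: "form (Suc d - j) (\<lambda>u. if j \<le> d then (A *v u) $ i * g j u else 0)"
      using form_mult[OF lin g(1)[of j]] by (cases "j \<le> d") (auto simp: Suc_diff_le form_zero)
    have 2: "form (Suc d - j) (\<lambda>u. if j = 0 then 0 else p $ i * g (j - 1) u)"
      using form_scale[OF g(1)[of "j - 1"]] that by (cases j) (auto simp: form_zero)
    show ?thesis unfolding h_def by (rule form.add[OF 1 2])
  qed
  moreover have "(A *v u + t *s p) $ i * f (A *v u + t *s p) = (\<Sum>j\<le>Suc d. t ^ j * h j u)" for u t
  proof -
    have "(\<Sum>j\<le>Suc d. t ^ j * h j u) =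
      (\<Sum>j\<le>Suc d. t ^ j * (if j \<le> d then (A *v u) $ i * g j u else 0)) +
      (\<Sum>j\<le>Suc d. t ^ j * (if j = 0 then 0 else p $ i * g (j - 1) u))"
      unfolding h_def by (simp add: distrib_left sum.distrib del: sum.atMost_Suc)
    also have "(\<Sum>j\<le>Suc d. t ^ j * (if j \<le> d then (A *v u) $ i * g j u else 0)) =
      (A *v u) $ i * (\<Sum>j\<le>d. t ^ j * g j u)"
      by (auto simp: sum_distrib_left mult_ac intro!: sum.cong)
    also have "(\<Sum>j\<le>Suc d. t ^ j * (if j = 0 then 0 else p $ i * g (j - 1) u)) =
      t * p $ i * (\<Sum>j\<le>d. t ^ j * g j u)"
      by (subst sum.atMost_Suc_shift) (auto simp: sum_distrib_left mult_ac intro!: sum.cong)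
    finally show ?thesis by (simp add: g(2) distrib_right)
  qed
  ultimately show ?case by blast
qed

lemma poly_sum_monom:
  fixes c :: "nat \<Rightarrow> 'a::comm_semiring_1"
  shows "poly (\<Sum>j\<le>d. Polynomial.monom (c j) j) t = (\<Sum>j\<le>d. t ^ j * c j)"
  by (simp add: poly_sum Polynomial.poly_monom mult.commute)

lemma degree_sum_monom: "Polynomial.degree (\<Sum>j\<le>d. Polynomial.monom (c j) j) \<le> d"
  by (intro degree_sum_le) (auto intro: order_trans[OF Polynomial.degree_monom_le])

lemma coeff_sum_monom: "k \<le> d \<Longrightarrow> Polynomial.coeff (\<Sum>j\<le>d. Polynomial.monom (c j) j) k = c k"
  by (simp add: coeff_sum)

lemma form_line:
  fixes f :: "'a::comm_ring_1 ^ 'n::finite \<Rightarrow> 'a"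
  assumes "form d f"
  shows "\<exists>P. Polynomial.degree P \<le> d \<and> (\<forall>t. poly P t = f (x + t *s y))"
proof -
  obtain g where "\<forall>u t. f (mat 1 *v u + t *s y) = (\<Sum>j\<le>d. t ^ j * g j u)"
    using form_expand[OF assms] by blast
  then show ?thesis
    by (intro exI[of _ "\<Sum>j\<le>d. Polynomial.monom (g j x) j"]) (simp add: poly_sum_monom degree_sum_monom)
qed

lemma form_line_roots:
  fixes f :: "'a::{field,finite} ^ 'n::finite \<Rightarrow> 'a"
  assumes "form d f" "f (x + s *s y) \<noteq> 0"
  shows "card {t. f (x + t *s y) = 0} \<le> d"
proof -
  obtain P where P: "Polynomial.degree P \<le> d" "\<forall>t. poly P t = f (x + t *s y)"
    using form_line[OF assms(1)] by blast
  then have "P \<noteq> 0" using assms(2) by fastforce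
  from poly_roots_card_le[OF this P(1)] P(2) show ?thesis by simp
qed

text \<open>Both forms are restricted to the line through x and y. As f x and g y are nonzero, f has
  at most a zeros of the shape x + t y and g at most b of the shape y + s x; homogeneity identifies
  the two by s = 1 / t. The value t = 0 has no inverse, which costs the extra 1 in
  \<open>small\<close>.\<close>

lemma form_mult_nonzero:
  fixes f g :: "'a::{field,finite} ^ 'n::finite \<Rightarrow> 'a"
  assumes f: "form a f" "f x \<noteq> 0" and g: "form b g" "g y \<noteq> 0" and small: "a + b + 1 < CARD('a)"
  shows "\<exists>z. f z * g z \<noteq> 0"
proof (rule ccontr)
  assume "\<not> ?thesis"
  then have *: "f z = 0 \<or> g z = 0" for z by auto
  have cf: "card {t. f (x + t *s y) = 0} \<le> a"
    using f by (intro form_line_roots[where s = 0]) auto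
  have cg: "card {t. g (y + t *s x) = 0} \<le> b"
    using g by (intro form_line_roots[where s = 0]) auto
  have "UNIV \<subseteq> insert 0 ({t. f (x + t *s y) = 0} \<union> inverse ` {t. g (y + t *s x) = 0})"
  proof
    fix t :: 'a
    show "t \<in> insert 0 ({t. f (x + t *s y) = 0} \<union> inverse ` {t. g (y + t *s x) = 0})"
    proof (cases "t = 0 \<or> f (x + t *s y) = 0")
      case False
      have "g (t *s (y + inverse t *s x)) = t ^ b * g (y + inverse t *s x)"
        by (rule form_homogeneous[OF g(1)])
      moreover have "t *s (y + inverse t *s x) = x + t *s y"
        using False by (simp add: vec.scale_right_distrib)
      ultimately have "t ^ b * g (y + inverse t *s x) = 0"
        using *[of "x + t *s y"] False by metis
      then have "inverse t \<in> {t. g (y + t *s x) = 0}"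
        using False by simp
      then show ?thesis using False by force
    qed auto
  qed
  then have "CARD('a) \<le> card (insert 0 ({t. f (x + t *s y) = 0} \<union> inverse ` {t. g (y + t *s x) = 0}))"
    by (intro card_mono) auto
  also have "\<dots> \<le> Suc (card {t. f (x + t *s y) = 0} + card {t. g (y + t *s x) = 0})"
  proof -
    have "card ({t. f (x + t *s y) = 0} \<union> inverse ` {t. g (y + t *s x) = 0}) \<le>
      card {t. f (x + t *s y) = 0} + card {t. g (y + t *s x) = 0}"
      by (rule order_trans[OF card_Un_le]) (simp add: card_image_le)
    then show ?thesis by (simp add: card_insert_if)
  qed
  finally show False using cf cg small by simp
qed

section \<open>Trace and norm of a field with q^2 elements\<close>

locale square_field =
  fixes q :: nat and field_type :: "'a::{field,finite} itself"
  assumes primepow_q: "primepow q" and card_field: "CARD('a) = q\<^sup>2"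
begin

lemma q_ge_2: "q \<ge> 2"
  using primepow_gt_Suc_0[OF primepow_q] by simp

lemma power_q_q [simp]: "((x::'a) ^ q) ^ q = x"
  using power_card_eq_same[of x] by (simp add: card_field power_mult power2_eq_square)

text \<open>Additivity of the q-th power needs q to be a power of the characteristic. The latter
  divides the field size, which is a power of the prime underlying q, so it equals that
  prime.\<close>

lemma q_power_char: "Factorial_Ring.prime CHAR('a) \<and> (\<exists>n. q = CHAR('a) ^ n)"
proof -
  obtain p k where pk: "Factorial_Ring.prime p" "q = p ^ k" using primepow_q by (auto simp: primepow_def)
  have "CHAR('a) > 0" by (rule finite_imp_CHAR_pos) simp
  then have *: "Factorial_Ring.prime CHAR('a)" by (rule prime_CHAR_semidom)
  have "CHAR('a) dvd p ^ (k * 2)"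
    using CHAR_dvd_CARD[where 'a = 'a] by (simp add: card_field pk power_mult)
  with * have "CHAR('a) dvd p" using prime_dvd_power by blast
  with * pk(1) have "CHAR('a) = p" by (simp add: primes_dvd_imp_eq)
  with * pk show ?thesis by auto
qed

lemma power_q_add: "((x::'a) + y) ^ q = x ^ q + y ^ q"
  using q_power_char freshmans_dream' by blast

lemma power_q_sum: "(\<Sum>i\<in>I. f i :: 'a) ^ q = (\<Sum>i\<in>I. f i ^ q)"
  using q_power_char freshmans_dream_sum' by blast

lemma power_q_minus: "(- (x::'a)) ^ q = - (x ^ q)"
  using power_q_add[of x "-x"] q_ge_2 by (simp add: eq_neg_iff_add_eq_0 add.commute power_0_left)

lemma power_q_diff: "((x::'a) - y) ^ q = x ^ q - y ^ q"
  using power_q_add[of "x - y" y] by (simp add: eq_diff_eq)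

lemma card_fixed_le: "card {c::'a. c ^ q = c} \<le> q"
proof -
  let ?p = "Polynomial.monom 1 q - Polynomial.monom 1 1 :: 'a poly"
  have "Polynomial.coeff ?p q = 1" using q_ge_2 by simp
  then have "?p \<noteq> 0" by (metis coeff_0 zero_neq_one)
  moreover have "Polynomial.degree ?p \<le> q"
    using q_ge_2 by (intro degree_diff_le) (auto intro: order_trans[OF Polynomial.degree_monom_le])
  ultimately have "card {x. poly ?p x = 0} \<le> q" by (rule poly_roots_card_le)
  then show ?thesis by (simp add: Polynomial.poly_monom)
qed

lemma card_trace_fibre_le: "card {t::'a. t + t ^ q = c} \<le> q"
proof -
  let ?p = "Polynomial.monom 1 q + Polynomial.monom 1 1 - Polynomial.monom c 0 :: 'a poly"
  have "Polynomial.coeff ?p q = 1" using q_ge_2 by simp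
  then have "?p \<noteq> 0" by (metis coeff_0 zero_neq_one)
  moreover have "Polynomial.degree ?p \<le> q"
    using q_ge_2 by (intro degree_diff_le degree_add_le) (auto intro: order_trans[OF Polynomial.degree_monom_le])
  ultimately have "card {x. poly ?p x = 0} \<le> q" by (rule poly_roots_card_le)
  then show ?thesis by (simp add: Polynomial.poly_monom add.commute)
qed

text \<open>The fibres have at most q elements and so does the set of fixed elements; q^2 field
  elements can only be accommodated if every fixed element is a trace.\<close>

lemma trace_surj: "(\<lambda>t::'a. t + t ^ q) ` UNIV = {c. c ^ q = c}"
proof (rule image_eq_if_card_fibres_le[where n = q])
  show "q * card {c::'a. c ^ q = c} \<le> card (UNIV :: 'a set)"
    using card_fixed_le by (simp add: card_field power2_eq_square)
qed (use q_ge_2 card_trace_fibre_le in \<open>auto simp: power_q_add add.commute\<close>)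

text \<open>Nonempty fibres are translates of the kernel, hence equally large. Their size times the
  number of fixed elements is q^2, and neither factor exceeds q.\<close>

lemma card_trace_fibre:
  assumes "(c::'a) ^ q = c"
  shows "card {t::'a. t + t ^ q = c} = q"
proof -
  obtain t0 where t0: "c = t0 + t0 ^ q" using trace_surj assms by blast
  have fib: "card {t \<in> UNIV. t + t ^ q = y} = card {t::'a. t + t ^ q = 0}"
    if "y \<in> (\<lambda>t::'a. t + t ^ q) ` UNIV" for y
  proof -
    from that obtain s where s: "y = s + s ^ q" by blast
    have "{t \<in> UNIV. t + t ^ q = y} = (\<lambda>t. t + s) ` {t. t + t ^ q = 0}"
    proof (intro equalityI subsetI)
      fix t assume "t \<in> {t \<in> UNIV. t + t ^ q = y}"
      then have "(t - s) + (t - s) ^ q = 0"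
        by (simp add: s power_q_diff flip: add_diff_eq) (simp add: algebra_simps)
      then show "t \<in> (\<lambda>t. t + s) ` {t. t + t ^ q = 0}" by (intro image_eqI[of _ _ "t - s"]) auto
    next
      fix t assume "t \<in> (\<lambda>t. t + s) ` {t. t + t ^ q = 0}"
      then show "t \<in> {t \<in> UNIV. t + t ^ q = y}"
        by (auto simp: s power_q_add algebra_simps)
    qed
    then show ?thesis by (simp add: card_image)
  qed
  have "q * q = card {t::'a. t + t ^ q = 0} * card {c::'a. c ^ q = c}"
    using card_fibres_eq[OF finite fib] trace_surj by (simp add: card_field power2_eq_square)
  also have "\<dots> \<le> card {t::'a. t + t ^ q = 0} * q"
    using card_fixed_le by simp
  finally have "q \<le> card {t::'a. t + t ^ q = 0}" using q_ge_2 by simp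
  with card_trace_fibre_le[of 0] fib[of c] t0 show ?thesis by auto
qed

lemma card_scaled_trace_fibre:
  assumes "(c::'a) ^ q = c" "b \<noteq> 0"
  shows "card {t::'a. t * b + (t * b) ^ q = c} = q"
proof -
  have "{t. t * b + (t * b) ^ q = c} = (\<lambda>t. t / b) ` {t. t + t ^ q = c}"
    using assms(2) by (auto intro!: image_eqI[of _ "\<lambda>t. t / b" "_ * b"])
  then show ?thesis using assms by (simp add: card_image inj_on_def card_trace_fibre)
qed

text \<open>The counting used for the trace, on nonzero elements: q + 1 bounds the fibres, q - 1 the
  targets, and the product of the two is the number of nonzero elements.\<close>

lemma norm_surj:
  assumes "(c::'a) ^ q = c"
  shows "\<exists>x. x ^ Suc q = c"
proof (cases "c = 0")
  case False
  have image: "(\<lambda>x::'a. x ^ Suc q) ` (UNIV - {0}) = {c. c ^ q = c} - {0}"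
  proof (rule image_eq_if_card_fibres_le[where n = "Suc q"])
    show "card {x \<in> UNIV - {0}. x ^ Suc q = y} \<le> Suc q" for y :: 'a
    proof -
      let ?p = "Polynomial.monom 1 (Suc q) - Polynomial.monom y 0 :: 'a poly"
      have "Polynomial.coeff ?p (Suc q) = 1" by simp
      then have "?p \<noteq> 0" by (metis coeff_0 zero_neq_one)
      moreover have "Polynomial.degree ?p \<le> Suc q"
        by (intro degree_diff_le) (auto intro: order_trans[OF Polynomial.degree_monom_le])
      ultimately have "card {x. poly ?p x = 0} \<le> Suc q" by (rule poly_roots_card_le)
      moreover have "card {x \<in> UNIV - {0}. x ^ Suc q = y} \<le> card {x. poly ?p x = 0}"
        by (intro card_mono) (auto simp: Polynomial.poly_monom)
      ultimately show ?thesis by simp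
    qed
    have "card ({c::'a. c ^ q = c} - {0}) \<le> q - 1"
      using card_fixed_le q_ge_2 by (subst card_Diff_singleton) auto
    then have "Suc q * card ({c::'a. c ^ q = c} - {0}) \<le> Suc q * (q - 1)" by (rule mult_le_mono2)
    also have "\<dots> = card (UNIV - {0::'a})"
      using q_ge_2 by (simp add: card_Diff_singleton card_field power2_eq_square algebra_simps)
    finally show "Suc q * card ({c::'a. c ^ q = c} - {0}) \<le> card (UNIV - {0::'a})" .
    show "(\<lambda>x::'a. x ^ Suc q) ` (UNIV - {0}) \<subseteq> {c. c ^ q = c} - {0}"
    proof
      fix c assume "c \<in> (\<lambda>x::'a. x ^ Suc q) ` (UNIV - {0})"
      then obtain x :: 'a where "c = x ^ Suc q" "x \<noteq> 0" by blast
      then show "c \<in> {c. c ^ q = c} - {0}" by (simp add: power_mult_distrib mult.commute)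
    qed
  qed simp_all
  have "c \<in> {c. c ^ q = c} - {0}" using assms False by simp
  then have "c \<in> (\<lambda>x::'a. x ^ Suc q) ` (UNIV - {0})" by (simp only: image)
  then show ?thesis by (elim imageE) (rule exI, erule sym)
next
  case True
  then have "0 ^ Suc q = c" by simp
  then show ?thesis by (rule exI)
qed

end

section \<open>Hermitian forms\<close>

text \<open>The sesquilinear form that polarises the equation of the Hermitian variety.\<close>

definition herm :: "nat \<Rightarrow> 'a::field ^ 'n::finite ^ 'n \<Rightarrow> 'a ^ 'n \<Rightarrow> 'a ^ 'n \<Rightarrow> 'a" where
  "herm q H x y = (\<Sum>i\<in>UNIV. \<Sum>j\<in>UNIV. H $ i $ j * x $ i * (y $ j) ^ q)"

lemma herm_add_left: "herm q H (x + y) z = herm q H x z + herm q H y z"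
  by (simp add: herm_def algebra_simps sum.distrib)

lemma herm_scale_left: "herm q H (c *s x) z = c * herm q H x z"
  by (simp add: herm_def sum_distrib_left mult_ac)

lemma herm_zero_left [simp]: "herm q H 0 z = 0"
  using herm_scale_left[of q H 0] by simp

lemma herm_sum_left: "herm q H (\<Sum>i\<in>I. f i) z = (\<Sum>i\<in>I. herm q H (f i) z)"
  by (induction I rule: infinite_finite_induct) (auto simp: herm_add_left)

lemma herm_scale_right: "herm q H z (c *s x) = c ^ q * herm q H z x"
  by (simp add: herm_def sum_distrib_left mult_ac power_mult_distrib)

lemma herm_row: "herm q H x y = (\<Sum>j\<in>UNIV. (x v* H) $ j * (y $ j) ^ q)"
  unfolding herm_def vector_matrix_mult_def
  by (subst sum.swap) (simp add: sum_distrib_left mult_ac)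

lemma form_herm: "form 1 (\<lambda>x::'a::field^'n::finite. herm q H x y)"
proof -
  have "form 1 (\<lambda>x::'a^'n. \<Sum>i\<in>UNIV. (\<Sum>j\<in>UNIV. H $ i $ j * (y $ j) ^ q) * x $ i)"
    using form_coordinate by (auto intro!: form_sum form_scale)
  then show ?thesis by (simp add: herm_def sum_distrib_left mult_ac)
qed

context square_field
begin

lemma herm_add_right: "herm q H (z :: 'a ^ 'n::finite) (x + y) = herm q H z x + herm q H z y"
  by (simp add: herm_def power_q_add algebra_simps sum.distrib)

lemma herm_zero_right [simp]: "herm q H (z :: 'a ^ 'n::finite) 0 = 0"
  using herm_scale_right[of q H z 0 0] q_ge_2 by (simp add: power_0_left)

lemma herm_sum_right: "herm q H (z :: 'a ^ 'n::finite) (\<Sum>i\<in>I. f i) = (\<Sum>i\<in>I. herm q H z (f i))"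
  by (induction I rule: infinite_finite_induct) (auto simp: herm_add_right)

lemma herm_swap:
  assumes "hermitian_matrix q H"
  shows "herm q H y x = herm q H x (y :: 'a ^ 'n::finite) ^ q"
proof -
  have "herm q H x y ^ q = (\<Sum>i\<in>UNIV. \<Sum>j\<in>UNIV. (H $ i $ j) ^ q * (x $ i) ^ q * y $ j)"
    by (simp add: herm_def power_q_sum power_mult_distrib)
  also have "\<dots> = (\<Sum>i\<in>UNIV. \<Sum>j\<in>UNIV. H $ j $ i * (x $ i) ^ q * y $ j)"
  proof -
    have "(H $ i $ j) ^ q = H $ j $ i" for i j
      using assms unfolding hermitian_matrix_def by metis
    then show ?thesis by simp
  qed
  also have "\<dots> = herm q H y x"
    by (subst sum.swap) (simp add: herm_def mult_ac)
  finally show ?thesis by simp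
qed

lemma herm_swap_zero:
  assumes "hermitian_matrix q H" "herm q H x (y :: 'a ^ 'n::finite) = 0"
  shows "herm q H y x = 0"
  using herm_swap[OF assms(1), of y x] assms(2) q_ge_2 by simp

lemma herm_fixed:
  assumes "hermitian_matrix q H"
  shows "herm q H x (x :: 'a ^ 'n::finite) ^ q = herm q H x x"
  using herm_swap[OF assms, of x x] by simp

text \<open>The two mixed terms are conjugate, so they add up to the trace of
  \<open>t * herm q H y x\<close>. Finding isotropic vectors on a line in an isotropic direction
  thus becomes a trace equation.\<close>

lemma herm_line:
  assumes "hermitian_matrix q H"
  shows "herm q H (x + t *s y) (x + t *s (y :: 'a ^ 'n::finite)) =
    herm q H x x + (t * herm q H y x + (t * herm q H y x) ^ q) + t * t ^ q * herm q H y y"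
  by (simp add: herm_add_left herm_add_right herm_scale_left herm_scale_right
    herm_swap[OF assms, of x y] power_mult_distrib algebra_simps)

lemma herm_trace_zero:
  assumes "\<And>t::'a. t * b + (t * b) ^ q = 0"
  shows "b = 0"
proof (rule ccontr)
  assume "b \<noteq> 0"
  with card_scaled_trace_fibre[of 0 b] q_ge_2 have "card {t. t * b + (t * b) ^ q = 0} = q" by simp
  moreover have "{t. t * b + (t * b) ^ q = 0} = UNIV" using assms by simp
  ultimately show False using q_ge_2 by (simp add: card_field power2_eq_square)
qed

lemma herm_trace_solution:
  assumes "hermitian_matrix q H" "herm q H y y = 0" "herm q H y x \<noteq> 0"
  shows "card {t. herm q H (x + t *s y) (x + t *s (y :: 'a ^ 'n::finite)) = 0} = q"
proof -
  have "card {t. t * herm q H y x + (t * herm q H y x) ^ q = - herm q H x x} = q"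
    using assms by (intro card_scaled_trace_fibre) (auto simp: power_q_minus herm_fixed)
  then show ?thesis using assms by (simp add: herm_line eq_neg_iff_add_eq_0 add.commute)
qed

text \<open>If p pairs nontrivially with y, some \<open>y + t *s p\<close> is isotropic. The cone
  condition then makes its whole translate along p isotropic, so a trace would vanish for all
  parameters.\<close>

lemma isotropic_vertex_in_radical:
  assumes H: "hermitian_matrix q H" and p: "herm q H p p = 0"
    and cone: "\<And>x t. herm q H x x = 0 \<Longrightarrow> herm q H (x + t *s p) (x + t *s p) = 0"
  shows "herm q H p (y :: 'a ^ 'n::finite) = 0"
proof (rule ccontr)
  assume b: "herm q H p y \<noteq> 0"
  have "{t. herm q H (y + t *s p) (y + t *s p) = 0} \<noteq> {}"
    using herm_trace_solution[OF H p b] q_ge_2 by (metis card.empty not_numeral_le_zero)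
  then obtain t where t: "herm q H (y + t *s p) (y + t *s p) = 0" by blast
  have pb: "herm q H p (y + t *s p) = herm q H p y"
    by (simp add: herm_add_right herm_scale_right p)
  have "s * herm q H p y + (s * herm q H p y) ^ q = 0" for s
    using cone[OF t, of s] unfolding herm_line[OF H, of "y + t *s p"] pb t p by simp
  with b show False using herm_trace_zero by blast
qed

section \<open>Orthonormal frames and isometries\<close>

text \<open>Gram-Schmidt. The orthogonal complement \<open>W\<close> of the given vectors contains
  an anisotropic vector; otherwise the form vanishes on \<open>W\<close> altogether,
  \<open>W\<close> lies in the radical, and the rank is at most k. Surjectivity of the norm rescales
  that vector to length 1.\<close>

lemma orthonormal_extend:
  fixes v :: "nat \<Rightarrow> 'a ^ 'n::finite"
  assumes H: "hermitian_matrix q H" and "k < rank H"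
    and v: "\<And>i j. i < k \<Longrightarrow> j < k \<Longrightarrow> herm q H (v i) (v j) = of_bool (i = j)"
  shows "\<exists>w. herm q H w w = 1 \<and> (\<forall>i<k. herm q H (v i) w = 0 \<and> herm q H w (v i) = 0)"
proof -
  define W where "W = {w. \<forall>i<k. herm q H w (v i) = 0}"
  define pr where "pr x = (\<Sum>i<k. herm q H x (v i) *s v i)" for x
  have prW: "x - pr x \<in> W" for x
  proof -
    have "herm q H x (v j) = herm q H (x - pr x) (v j) + herm q H x (v j)" if "j < k" for j
    proof -
      have "herm q H (pr x) (v j) = (\<Sum>i<k. if i = j then herm q H x (v i) else 0)"
        unfolding pr_def herm_sum_left using v that
        by (intro sum.cong) (auto simp: herm_scale_left)
      also have "\<dots> = herm q H x (v j)" using that by simp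
      finally show ?thesis using herm_add_left[of q H "x - pr x" "pr x" "v j"] by simp
    qed
    then show ?thesis by (auto simp: W_def)
  qed
  have "\<exists>w\<in>W. herm q H w w \<noteq> 0"
  proof (rule ccontr)
    assume "\<not> ?thesis"
    then have iso: "herm q H w w = 0" if "w \<in> W" for w using that by blast
    \<comment> \<open>Polarisation: all of w + t w' is isotropic, so every multiple of
      \<open>herm q H w' w\<close> has trace zero.\<close>
    have WW: "herm q H w' w = 0" if "w \<in> W" "w' \<in> W" for w w'
    proof (rule herm_trace_zero)
      fix t
      have "w + t *s w' \<in> W" using that by (auto simp: W_def herm_add_left herm_scale_left)
      then show "t * herm q H w' w + (t * herm q H w' w) ^ q = 0"
        using herm_line[OF H, of w t w'] iso that by simp
    qed
    have rad: "w v* H = 0" if w: "w \<in> W" for w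
    proof -
      have "herm q H w y = 0" for y
      proof -
        have "herm q H w (pr y) = 0"
          using w by (simp add: pr_def herm_sum_right herm_scale_right W_def)
        moreover have "herm q H w (y - pr y) = 0" using WW[OF prW w] .
        ultimately show ?thesis using herm_add_right[of H w "y - pr y" "pr y"] by simp
      qed
      then have "(\<Sum>j\<in>UNIV. (w v* H) $ j * (axis j' 1 $ j) ^ q) = 0" for j'
        by (simp add: herm_row)
      moreover have "(\<Sum>j\<in>UNIV. (w v* H) $ j * (axis j' 1 $ j) ^ q) = (w v* H) $ j'" for j'
      proof -
        have "(\<Sum>j\<in>UNIV. (w v* H) $ j * (axis j' 1 $ j) ^ q) = (\<Sum>j\<in>UNIV. if j = j' then (w v* H) $ j else 0)"
          using q_ge_2 by (intro sum.cong) (auto simp: axis_def power_0_left)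
        then show ?thesis by simp
      qed
      ultimately show ?thesis by (simp add: vec_eq_iff)
    qed
    \<comment> \<open>A standard basis vector differs from its projection by a vector of the
      radical, so its row of \<open>H\<close> is a combination of the k vectors
      \<open>v i v* H\<close>.\<close>
    have "rows H \<subseteq> vec.span ((\<lambda>i. v i v* H) ` {..<k})"
    proof
      fix r assume "r \<in> rows H"
      then obtain i where r: "r = row i H" by (auto simp: rows_def)
      define e where "e = (axis i 1 :: 'a ^ 'n)"
      have "(\<Sum>l\<in>UNIV. H $ l $ j * e $ l) = (\<Sum>l\<in>UNIV. if l = i then H $ l $ j else 0)" for j
        by (intro sum.cong) (auto simp: e_def axis_def)
      then have "r = e v* H"
        by (simp add: r vector_matrix_mult_def row_def vec_eq_iff mult.commute)
      also have "\<dots> = (e - pr e) v* H + pr e v* H"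
        by (simp flip: vector_matrix_left_distrib)
      also have "\<dots> = pr e v* H" using rad[OF prW] by simp
      also have "\<dots> = (\<Sum>i<k. herm q H e (v i) *s (v i v* H))"
        unfolding pr_def vector_matrix_mult_def
        by (simp add: vec_eq_iff sum_distrib_left mult_ac) (subst sum.swap, simp)
      also have "\<dots> \<in> vec.span ((\<lambda>i. v i v* H) ` {..<k})"
        by (intro vec.span_sum vec.span_scale vec.span_base) auto
      finally show "r \<in> vec.span ((\<lambda>i. v i v* H) ` {..<k})" .
    qed
    then have "rank H \<le> card ((\<lambda>i. v i v* H) ` {..<k})"
      unfolding row_rank_def_gen by (intro vec.dim_le_card) auto
    also have "\<dots> \<le> k" using card_image_le[of "{..<k}"] by simp
    finally show False using assms(2) by simp
  qed
  then obtain w where w: "w \<in> W" "herm q H w w \<noteq> 0" by blast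
  obtain a where a: "a ^ Suc q = inverse (herm q H w w)"
    using norm_surj[of "inverse (herm q H w w)"] herm_fixed[OF H, of w] by (auto simp: power_inverse)
  have "herm q H (a *s w) (a *s w) = a ^ Suc q * herm q H w w"
    by (simp add: herm_scale_left herm_scale_right)
  also have "\<dots> = 1" using w(2) unfolding a by simp
  finally have "herm q H (a *s w) (a *s w) = 1" .
  moreover have "herm q H (a *s w) (v i) = 0" if "i < k" for i
    using w(1) that by (simp add: W_def herm_scale_left)
  ultimately show ?thesis using herm_swap_zero[OF H] by blast
qed

lemma orthonormal_exists:
  fixes H :: "'a ^ 'n::finite ^ 'n"
  assumes H: "hermitian_matrix q H"
  shows "k \<le> rank H \<Longrightarrow> \<exists>v. \<forall>i<k. \<forall>j<k. herm q H (v i) (v j) = of_bool (i = j)"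
proof (induction k)
  case (Suc k)
  then obtain v where v: "\<forall>i<k. \<forall>j<k. herm q H (v i) (v j) = of_bool (i = j)" by auto
  have "k < rank H" using Suc.prems by simp
  from orthonormal_extend[OF H this, of v] v
  obtain w where w: "herm q H w w = 1" "\<forall>i<k. herm q H (v i) w = 0 \<and> herm q H w (v i) = 0"
    by blast
  have "herm q H ((v(k := w)) i) ((v(k := w)) j) = of_bool (i = j)" if "i < Suc k" "j < Suc k" for i j
    using v w that by (cases "i = k"; cases "j = k") (simp_all add: less_Suc_eq)
  then show ?case by (intro exI[of _ "v(k := w)"] allI impI)
qed simp

lemma orthonormal_frame:
  fixes H :: "'a ^ 'n::finite ^ 'n"
  assumes H: "hermitian_matrix q H" and "CARD('m::finite) \<le> rank H"
  shows "\<exists>A :: 'a ^ 'm ^ 'n. \<forall>c d. herm q H (A *v c) (A *v d) = (\<Sum>i\<in>UNIV. c $ i * (d $ i) ^ q)"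
proof -
  from orthonormal_exists[OF H assms(2)]
  obtain v where v: "\<forall>i<CARD('m). \<forall>j<CARD('m). herm q H (v i) (v j) = of_bool (i = j)" ..
  obtain h where h: "bij_betw h (UNIV :: 'm set) {0..<CARD('m)}"
    using ex_bij_betw_finite_nat[of "UNIV :: 'm set"] by auto
  define A :: "'a ^ 'm ^ 'n" where "A = (\<chi> i j. v (h j) $ i)"
  have A: "A *v c = (\<Sum>j\<in>UNIV. c $ j *s v (h j))" for c
    by (simp add: A_def vec_eq_iff matrix_vector_mult_def mult.commute)
  have hv: "herm q H (v (h i)) (v (h j)) = of_bool (i = j)" for i j
    using v h bij_betwE[OF h] by (auto simp: bij_betw_def inj_on_def)
  have "herm q H (A *v c) (A *v d) = (\<Sum>i\<in>UNIV. c $ i * (d $ i) ^ q)" for c d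
  proof -
    have "(\<Sum>j\<in>UNIV. d $ j ^ q * of_bool (i = j)) = (\<Sum>j\<in>UNIV. if i = j then d $ j ^ q else 0)" for i
      by (intro sum.cong) auto
    then have "(\<Sum>i\<in>UNIV. c $ i * (\<Sum>j\<in>UNIV. d $ j ^ q * of_bool (i = j))) = (\<Sum>i\<in>UNIV. c $ i * (d $ i) ^ q)"
      by simp
    then show ?thesis
      unfolding A herm_sum_left herm_scale_left herm_sum_right herm_scale_right hv .
  qed
  then show ?thesis by blast
qed

lemma diagonal_nondegenerate:
  assumes "\<And>d. (\<Sum>i\<in>UNIV. (c :: 'a ^ 'm::finite) $ i * (d $ i) ^ q) = 0"
  shows "c = 0"
proof -
  have "c $ i = 0" for i
  proof -
    have "(\<Sum>j\<in>UNIV. c $ j * ((axis i 1 :: 'a ^ 'm) $ j) ^ q) = (\<Sum>j\<in>UNIV. if j = i then c $ j else 0)"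
      using q_ge_2 by (intro sum.cong) (auto simp: axis_def power_0_left)
    then show ?thesis using assms[of "axis i 1"] by simp
  qed
  then show ?thesis by (simp add: vec_eq_iff)
qed

text \<open>The diagonal form is the common model of both. The frame \<open>B\<close> of
  \<open>U\<close> is injective because the diagonal form is nondegenerate; being square it has an
  inverse \<open>B'\<close>, and \<open>A ** B'\<close> carries one form to the other.\<close>

lemma isometry:
  fixes U :: "'a ^ 'm::finite ^ 'm" and H :: "'a ^ 'n::finite ^ 'n"
  assumes U: "hermitian_matrix q U" "rank U = CARD('m)"
    and H: "hermitian_matrix q H" "CARD('m) \<le> rank H"
  shows "\<exists>A :: 'a ^ 'm ^ 'n. \<forall>x y. herm q H (A *v x) (A *v y) = herm q U x y"
proof -
  have "CARD('m) \<le> rank U" using U(2) by simp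
  from orthonormal_frame[OF U(1) this]
  obtain B :: "'a ^ 'm ^ 'm" where B: "\<forall>c d. herm q U (B *v c) (B *v d) = (\<Sum>i\<in>UNIV. c $ i * (d $ i) ^ q)" ..
  have "CARD('m) \<le> rank H" using H(2) by simp
  from orthonormal_frame[OF H(1) this]
  obtain A :: "'a ^ 'm ^ 'n" where A: "\<forall>c d. herm q H (A *v c) (A *v d) = (\<Sum>i\<in>UNIV. c $ i * (d $ i) ^ q)" ..
  have "c = 0" if "B *v c = 0" for c
  proof (rule diagonal_nondegenerate)
    show "(\<Sum>i\<in>UNIV. c $ i * (d $ i) ^ q) = 0" for d
      using B[rule_format, of c d] that by simp
  qed
  then obtain B' where "B' ** B = mat 1"
    using matrix_left_invertible_ker[of B] by auto
  then have "B ** B' = mat 1" by (simp add: matrix_left_right_inverse)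
  then have BB': "B *v (B' *v x) = x" for x by (simp add: matrix_vector_mul_assoc)
  have "herm q H ((A ** B') *v x) ((A ** B') *v y) = herm q U x y" for x y
    using A[rule_format, of "B' *v x" "B' *v y"] B[rule_format, of "B' *v x" "B' *v y"]
    by (simp only: BB' matrix_vector_mul_assoc[symmetric])
  then show ?thesis by blast
qed

lemma full_rank_nondegenerate:
  fixes U :: "'a ^ 'm::finite ^ 'm"
  assumes U: "hermitian_matrix q U" "rank U = CARD('m)" and "\<And>y. herm q U x y = 0"
  shows "x = 0"
proof -
  have "CARD('m) \<le> rank U" using U(2) by simp
  from orthonormal_frame[OF U(1) this]
  obtain B :: "'a ^ 'm ^ 'm" where B: "\<forall>c d. herm q U (B *v c) (B *v d) = (\<Sum>i\<in>UNIV. c $ i * (d $ i) ^ q)" ..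
  have "c = 0" if "B *v c = 0" for c
  proof (rule diagonal_nondegenerate)
    show "(\<Sum>i\<in>UNIV. c $ i * (d $ i) ^ q) = 0" for d
      using B[rule_format, of c d] that by simp
  qed
  then obtain B' where "B' ** B = mat 1"
    using matrix_left_invertible_ker[of B] by auto
  then have "B ** B' = mat 1" by (simp add: matrix_left_right_inverse)
  then have x: "x = B *v (B' *v x)" by (simp add: matrix_vector_mul_assoc)
  have "B' *v x = 0"
  proof (rule diagonal_nondegenerate)
    show "(\<Sum>i\<in>UNIV. (B' *v x) $ i * (d $ i) ^ q) = 0" for d
      using B[rule_format, of "B' *v x" d] assms(3) x by metis
  qed
  with x show ?thesis by simp
qed

end

section \<open>Nondegenerate Hermitian surfaces\<close>

text \<open>Removing an element of least value never lowers the average; this is repeated until k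
  elements are left.\<close>

lemma subset_sum_ge_average:
  fixes f :: "'b \<Rightarrow> nat"
  assumes "finite A" "k \<le> card A"
  shows "\<exists>B\<subseteq>A. card B = k \<and> k * sum f A \<le> card A * sum f B"
  using assms
proof (induction "card A" arbitrary: A)
  case 0
  then show ?case by (intro exI[of _ "{}"]) auto
next
  case (Suc n)
  show ?case
  proof (cases "k = Suc n")
    case True
    then show ?thesis using Suc by (intro exI[of _ A]) auto
  next
    case False
    with Suc have kn: "k \<le> n" by simp
    have "A \<noteq> {}" using Suc.hyps(2) by auto
    with Suc.prems(1) obtain a where a: "a \<in> A" "\<And>b. b \<in> A \<Longrightarrow> f a \<le> f b"
      using arg_min_if_finite[of A f] by (metis not_less)
    have cA: "card (A - {a}) = n" using a Suc.hyps(2) Suc.prems(1) by simp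
    from Suc.hyps(1)[of "A - {a}"] cA kn Suc.prems(1)
    obtain B where B: "B \<subseteq> A - {a}" "card B = k" "k * sum f (A - {a}) \<le> n * sum f B" by auto
    have "card A * f a \<le> sum f A"
      using sum_bounded_below[of A "f a" f] a(2) by simp
    moreover have split: "sum f A = f a + sum f (A - {a})" using a Suc.prems(1) by (simp add: sum.remove)
    ultimately have *: "n * f a \<le> sum f (A - {a})" unfolding Suc.hyps(2)[symmetric] by simp
    have "k * sum f A \<le> Suc n * sum f B"
    \<comment> \<open>The comparison of averages is multiplied by n to avoid division. Cancelling n
      needs n > 0, and n = 0 forces k = 0.\<close>
    proof (cases "n = 0")
      case False
      have "n * (k * sum f A) = k * (n * f a) + n * (k * sum f (A - {a}))"
        by (simp add: split algebra_simps)
      also have "\<dots> \<le> k * sum f (A - {a}) + n * (k * sum f (A - {a}))"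
        using * by simp
      also have "\<dots> = Suc n * (k * sum f (A - {a}))" by simp
      also have "\<dots> \<le> Suc n * (n * sum f B)" using B(3) by (rule mult_le_mono2)
      also have "\<dots> = n * (Suc n * sum f B)" by (rule mult.left_commute)
      finally show ?thesis using False by (simp only: nat_mult_le_cancel_disj simp_thms)
    qed (use kn in simp)
    then show ?thesis using B Suc.hyps(2) by (intro exI[of _ B]) auto
  qed
qed

text \<open>The fibres of a nonzero functional are translates of its kernel. Cardinalities stand in
  for dimensions in all that follows.\<close>

lemma card_subspace_kernel:
  fixes V :: "('a::{field,finite} ^ 'n::finite) set"
  assumes V: "vec.subspace V" and add: "\<And>x y. \<alpha> (x + y) = \<alpha> x + \<alpha> y"
    and scale: "\<And>c x. \<alpha> (c *s x) = c * \<alpha> x"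
    and x0: "x0 \<in> V" "\<alpha> x0 \<noteq> 0"
  shows "card V = CARD('a) * card {x \<in> V. \<alpha> x = 0}"
proof -
  have fib: "card {x \<in> V. \<alpha> x = c} = card {x \<in> V. \<alpha> x = 0}" for c
  proof (rule bij_betw_same_card[OF bij_betwI])
    let ?w = "(c / \<alpha> x0) *s x0"
    have w: "?w \<in> V" "\<alpha> ?w = c" using V x0 by (auto simp: scale vec.subspace_scale)
    have sub: "\<alpha> (x - y) = \<alpha> x - \<alpha> y" for x y
      using add[of "x - y" y] by simp
    show "(\<lambda>x. x - ?w) \<in> {x \<in> V. \<alpha> x = c} \<rightarrow> {x \<in> V. \<alpha> x = 0}"
      using w V by (auto simp: sub vec.subspace_diff)
    show "(\<lambda>x. x + ?w) \<in> {x \<in> V. \<alpha> x = 0} \<rightarrow> {x \<in> V. \<alpha> x = c}"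
      using w V by (auto simp: add vec.subspace_add)
  qed auto
  have "c \<in> \<alpha> ` V" for c
    using V x0 by (intro image_eqI[of _ _ "(c / \<alpha> x0) *s x0"]) (auto simp: scale vec.subspace_scale)
  then have "\<alpha> ` V = UNIV" by auto
  moreover have "card V = card {x \<in> V. \<alpha> x = 0} * card (\<alpha> ` V)"
    by (rule card_fibres_eq[OF _ fib]) simp
  ultimately show ?thesis by simp
qed

lemma form_prod_nonzero:
  fixes g :: "'a::{field,finite} ^ 'n::finite \<Rightarrow> 'a"
  assumes "finite B" and g: "form e g" "\<exists>x. g x \<noteq> 0"
    and L: "\<And>a. a \<in> B \<Longrightarrow> form 1 (L a)" "\<And>a. a \<in> B \<Longrightarrow> \<exists>x. L a x \<noteq> 0"
    and "e + card B + 1 < CARD('a)"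
  shows "form (e + card B) (\<lambda>x. g x * (\<Prod>a\<in>B. L a x)) \<and> (\<exists>x. g x * (\<Prod>a\<in>B. L a x) \<noteq> 0)"
  using assms(1) L assms(6)
proof (induction B rule: finite_induct)
  case empty
  then show ?case using g by simp
next
  case (insert a B)
  then have IH: "form (e + card B) (\<lambda>x. g x * (\<Prod>a\<in>B. L a x))"
    "\<exists>x. g x * (\<Prod>a\<in>B. L a x) \<noteq> 0" by auto
  obtain x where x: "g x * (\<Prod>a\<in>B. L a x) \<noteq> 0" using IH(2) by blast
  obtain y where y: "L a y \<noteq> 0" using insert.prems(2) by blast
  have La: "form 1 (L a)" using insert.prems by simp
  have "\<exists>z. (g z * (\<Prod>a\<in>B. L a z)) * L a z \<noteq> 0"
    using form_mult_nonzero[OF IH(1) x La y] insert by simp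
  moreover have "form (e + card B + 1) (\<lambda>x. (g x * (\<Prod>a\<in>B. L a x)) * L a x)"
    by (rule form_mult[OF IH(1) La])
  ultimately show ?case using insert.hyps by (simp add: mult_ac)
qed

text \<open>
  The bound on \<open>m\<close> is the number \<open>(q\<^sup>4 - 1)(q\<^sup>3 + 1)\<close> of nonzero isotropic vectors in dimension 4, and the
  bound on \<open>s\<close> is the number of vectors of a generator on which a form of degree \<open>e\<close> must be nonzero if it
  does not vanish on the generator.
\<close>

lemma gain_inequality:
  fixes q e k m s N :: nat
  assumes "q \<ge> 2" "k \<ge> 1" "e + k \<le> q - 1"
    and m: "m + 1 + q ^ 3 \<le> q ^ 7 + q ^ 4" and s: "(q\<^sup>2 - 1) * (q\<^sup>2 - e) \<le> s" "s \<le> m"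
    and N: "k * (m - s) \<le> (q\<^sup>2 + 1) * N"
  shows "k * m < q\<^sup>2 * (s + N)"
proof -
  define x where "x = int q"
  have x: "x \<ge> 2" using assms(1) by (simp add: x_def)
  have ek: "int e + int k \<le> x - 1" using assms(1,3) by (simp add: x_def)
  have QX: "int (q\<^sup>2) = x\<^sup>2" by (simp add: x_def)
  have xx: "x \<le> x\<^sup>2" using x by (simp add: power2_eq_square)
  have "q \<le> q\<^sup>2" using assms(1) by (simp add: power2_eq_square)
  with assms(3) have "e \<le> q\<^sup>2" by linarith
  then have "int ((q\<^sup>2 - 1) * (q\<^sup>2 - e)) = (x\<^sup>2 - 1) * (x\<^sup>2 - int e)"
    using assms(1) by (simp add: of_nat_diff x_def)
  with s(1) have s': "(x\<^sup>2 - 1) * (x\<^sup>2 - int e) \<le> int s" by linarith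
  have m': "int m \<le> (x\<^sup>2 - 1) * ((x\<^sup>2 + 1) * (x ^ 3 + 1))"
  proof -
    have "int (m + 1 + q ^ 3) \<le> int (q ^ 7 + q ^ 4)" using m by linarith
    then have "int m \<le> x ^ 7 + x ^ 4 - x ^ 3 - 1" by (simp add: x_def)
    also have "\<dots> = (x\<^sup>2 - 1) * ((x\<^sup>2 + 1) * (x ^ 3 + 1))" by (simp add: algebra_simps eval_nat_numeral)
    finally show ?thesis .
  qed
  have N': "int k * (int m - int s) \<le> (x\<^sup>2 + 1) * int N"
  proof -
    have "int (k * (m - s)) \<le> int ((q\<^sup>2 + 1) * N)" using N by linarith
    then show ?thesis using s(2) by (simp add: of_nat_diff x_def algebra_simps)
  qed
  \<comment> \<open>Up to a nonnegative excess of k + e * k, the product depends only on the sum e +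
    k, whose largest value is x - 1.\<close>
  have "(x\<^sup>2 + 1) * (x\<^sup>2 - x + 1) \<le> (x\<^sup>2 - int e) * (x\<^sup>2 + 1 - int k)"
  proof -
    have "(x\<^sup>2 - int e) * (x\<^sup>2 + 1 - int k) =
      (x\<^sup>2 + 1) * (x\<^sup>2 - (int e + int k)) + int k + int e * int k" by (simp add: algebra_simps)
    moreover have "(x\<^sup>2 + 1) * (x\<^sup>2 - x + 1) \<le> (x\<^sup>2 + 1) * (x\<^sup>2 - (int e + int k))"
      using ek by (intro mult_left_mono) auto
    moreover have "0 \<le> int k + int e * int k" by simp
    ultimately show ?thesis by linarith
  qed
  then have "x\<^sup>2 * ((x\<^sup>2 + 1) * (x\<^sup>2 - x + 1)) \<le> x\<^sup>2 * ((x\<^sup>2 - int e) * (x\<^sup>2 + 1 - int k))"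
    by (rule mult_left_mono) simp
  moreover have "int k * ((x\<^sup>2 + 1) * (x ^ 3 + 1)) \<le> (x - 1) * ((x\<^sup>2 + 1) * (x ^ 3 + 1))"
    using ek x by (intro mult_right_mono) auto
  moreover have "(x - 1) * ((x\<^sup>2 + 1) * (x ^ 3 + 1)) < x\<^sup>2 * ((x\<^sup>2 + 1) * (x\<^sup>2 - x + 1))"
  proof -
    \<comment> \<open>As x^3 + 1 = (x + 1) * (x^2 - x + 1), this says that x^2 - 1 < x^2.\<close>
    have "(x - 1) * (x ^ 3 + 1) < x\<^sup>2 * (x\<^sup>2 - x + 1)"
      using xx by (simp add: algebra_simps eval_nat_numeral)
    then have "(x\<^sup>2 + 1) * ((x - 1) * (x ^ 3 + 1)) < (x\<^sup>2 + 1) * (x\<^sup>2 * (x\<^sup>2 - x + 1))"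
      by (intro mult_strict_left_mono) (auto simp: add_nonneg_pos)
    then show ?thesis by (simp add: mult.left_commute)
  qed
  ultimately have "int k * ((x\<^sup>2 + 1) * (x ^ 3 + 1)) < x\<^sup>2 * ((x\<^sup>2 - int e) * (x\<^sup>2 + 1 - int k))"
    by linarith
  moreover have p1: "0 < x\<^sup>2 - 1" using xx x by linarith
  ultimately have "(x\<^sup>2 - 1) * (int k * ((x\<^sup>2 + 1) * (x ^ 3 + 1))) <
    (x\<^sup>2 - 1) * (x\<^sup>2 * ((x\<^sup>2 - int e) * (x\<^sup>2 + 1 - int k)))"
    by (rule mult_strict_left_mono)
  moreover have "int k * int m \<le> int k * ((x\<^sup>2 - 1) * ((x\<^sup>2 + 1) * (x ^ 3 + 1)))"
    using m' by (rule mult_left_mono) simp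
  moreover have "x\<^sup>2 * (x\<^sup>2 + 1 - int k) * ((x\<^sup>2 - 1) * (x\<^sup>2 - int e)) \<le> x\<^sup>2 * (x\<^sup>2 + 1 - int k) * int s"
    using s' ek xx by (intro mult_left_mono mult_nonneg_nonneg) auto
  \<comment> \<open>This is the claim with N replaced by its lower bound k * (m - s) / (x^2 + 1) and
    the denominator cleared.\<close>
  ultimately have "int k * int m < x\<^sup>2 * (x\<^sup>2 + 1 - int k) * int s"
    by (simp add: mult_ac)
  moreover have "x\<^sup>2 * (int k * (int m - int s)) \<le> x\<^sup>2 * ((x\<^sup>2 + 1) * int N)"
    using N' by (rule mult_left_mono) simp
  ultimately have "(x\<^sup>2 + 1) * (int k * int m) < (x\<^sup>2 + 1) * (x\<^sup>2 * (int s + int N))"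
    by (simp add: algebra_simps)
  then have "int k * int m < x\<^sup>2 * (int s + int N)"
    by (rule mult_left_less_imp_less) simp
  then have "int (k * m) < int (q\<^sup>2 * (s + N))" by (simp add: x_def)
  then show ?thesis by linarith
qed

section \<open>Isotropic vectors of a nondegenerate form in dimension 4\<close>

locale hermitian_surface = square_field q field_type
  for q :: nat and field_type :: "'a::{field,finite} itself" +
  fixes U :: "'a ^ 4 ^ 4"
  assumes hermitian: "hermitian_matrix q U" and full_rank: "rank U = 4"
begin

abbreviation h :: "'a ^ 4 \<Rightarrow> 'a ^ 4 \<Rightarrow> 'a" where "h \<equiv> herm q U"

lemma nondegenerate: "(\<And>y. h x y = 0) \<Longrightarrow> x = 0"
  using full_rank_nondegenerate[OF hermitian] full_rank by simp

lemma nondegenerate_left: "x \<noteq> 0 \<Longrightarrow> \<exists>y. h y x \<noteq> 0"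
  using nondegenerate herm_swap_zero[OF hermitian] by blast

lemma subspace_orth:
  assumes "vec.subspace V"
  shows "vec.subspace {x \<in> V. h x y = 0}"
  using assms by (auto simp: vec.subspace_def herm_add_left herm_scale_left)

lemma card_orth_eq:
  assumes "vec.subspace V" "x \<in> V" "h x y \<noteq> 0"
  shows "card V = q\<^sup>2 * card {x \<in> V. h x y = 0}"
  using card_subspace_kernel[where \<alpha> = "\<lambda>x. h x y", OF assms(1) _ _ assms(2,3)]
  by (simp add: herm_add_left herm_scale_left card_field)

lemma card_orth_ge:
  assumes "vec.subspace V"
  shows "card V \<le> q\<^sup>2 * card {x \<in> V. h x y = 0}"
proof (cases "\<exists>x\<in>V. h x y \<noteq> 0")
  case True
  then show ?thesis using card_orth_eq[OF assms] by auto
next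
  case False
  then have "{x \<in> V. h x y = 0} = V" by auto
  then show ?thesis using q_ge_2 by simp
qed

lemma exists_not_multiple:
  assumes "card V > q\<^sup>2"
  shows "\<exists>x\<in>V. \<forall>a. x \<noteq> a *s (u :: 'a ^ 4)"
proof (rule ccontr)
  assume "\<not> ?thesis"
  then have "V \<subseteq> range (\<lambda>a. a *s u)" by auto
  then have "card V \<le> card (range (\<lambda>a. a *s u))" by (intro card_mono) auto
  also have "\<dots> \<le> q\<^sup>2" using card_image_le[of UNIV "\<lambda>a. a *s u"] by (simp add: card_field)
  finally show False using assms by simp
qed

text \<open>Among the vectors of V that are not multiples of u, take y and then z orthogonal to y;
  the sizes leave room for both. A suitable norm makes y + a z isotropic. If this were a multiple of
  u, pairing it with y would give h y y = 0. The case u = 0 yields an isotropic vector at all, the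
  case of an isotropic u a generator through it.\<close>

lemma exists_isotropic:
  assumes V: "vec.subspace V" "card V \<ge> q ^ 6" and u: "\<And>x. x \<in> V \<Longrightarrow> h x u = 0"
  shows "\<exists>x\<in>V. h x x = 0 \<and> (\<forall>a. x \<noteq> a *s u)"
proof (rule ccontr)
  assume "\<not> ?thesis"
  then have aniso: "h x x \<noteq> 0" if "x \<in> V" "\<forall>a. x \<noteq> a *s u" for x using that by blast
  have q24: "q\<^sup>2 < q ^ 4" "q ^ 4 < q ^ 6" using q_ge_2 by (auto intro: power_strict_increasing)
  then obtain y where y: "y \<in> V" "\<forall>a. y \<noteq> a *s u" using exists_not_multiple[of V u] V(2) by auto
  have "q\<^sup>2 * q ^ 4 \<le> q\<^sup>2 * card {x \<in> V. h x y = 0}"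
    using card_orth_ge[OF V(1), of y] V(2) by (simp flip: power_add)
  then have "q ^ 4 \<le> card {x \<in> V. h x y = 0}" using q_ge_2 by (subst (asm) nat_mult_le_cancel1) auto
  then obtain z where z: "z \<in> V" "h z y = 0" "\<forall>a. z \<noteq> a *s u"
    using exists_not_multiple[of "{x \<in> V. h x y = 0}" u] q24 by auto
  have yz: "h y z = 0" using herm_swap_zero[OF hermitian z(2)] .
  obtain a where a: "a ^ Suc q = - h y y / h z z"
    using norm_surj[of "- h y y / h z z"] herm_fixed[OF hermitian, of y] herm_fixed[OF hermitian, of z]
    by (auto simp: power_divide power_q_minus)
  have "h (y + a *s z) (y + a *s z) = h y y + a ^ Suc q * h z z"
    by (simp add: herm_add_left herm_add_right herm_scale_left herm_scale_right z(2) yz)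
  also have "\<dots> = 0" unfolding a using aniso[OF z(1,3)] by simp
  finally have "h (y + a *s z) (y + a *s z) = 0" .
  moreover have "y + a *s z \<in> V" using V(1) y(1) z(1) by (simp add: vec.subspace_add vec.subspace_scale)
  ultimately obtain b where b: "y + a *s z = b *s u" using aniso by blast
  have "h u y = 0" using herm_swap_zero[OF hermitian u[OF y(1)]] .
  then have "h (y + a *s z) y = 0" unfolding b by (simp add: herm_scale_left)
  then have "h y y = 0" by (simp add: herm_add_left herm_scale_left z(2))
  with aniso[OF y] show False by simp
qed

text \<open>Double count the pairs \<open>(x, t)\<close> with \<open>x + t u\<close> isotropic.\<close>

lemma card_isotropic_not_orth:
  assumes V: "vec.subspace V" and u: "u \<in> V" "h u u = 0"
  shows "q\<^sup>2 * card {x \<in> V. h x u \<noteq> 0 \<and> h x x = 0} = q * card {x \<in> V. h x u \<noteq> 0}"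
proof -
  let ?N = "{x \<in> V. h x u \<noteq> 0}"
  \<comment> \<open>As u is isotropic, translations along u permute \<open>?N\<close>. Hence every t
    contributes the same number of pairs, while every x contributes q.\<close>
  have xu: "h (x + t *s u) u = h x u" for x t by (simp add: herm_add_left herm_scale_left u(2))
  have "(\<Sum>t\<in>(UNIV::'a set). card {x \<in> ?N. h (x + t *s u) (x + t *s u) = 0}) =
      (\<Sum>x\<in>?N. card {t. h (x + t *s u) (x + t *s u) = 0})"
    using sum.swap_restrict[of "UNIV :: 'a set" ?N "\<lambda>_ _. 1::nat" "\<lambda>t x. h (x + t *s u) (x + t *s u) = 0"]
    by simp
  also have "\<dots> = (\<Sum>x\<in>?N. q)"
    by (intro sum.cong refl herm_trace_solution[OF hermitian u(2)])
      (use herm_swap_zero[OF hermitian] in blast)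
  also have "(\<Sum>t\<in>(UNIV::'a set). card {x \<in> ?N. h (x + t *s u) (x + t *s u) = 0}) =
      (\<Sum>t\<in>(UNIV::'a set). card {x \<in> V. h x u \<noteq> 0 \<and> h x x = 0})"
  proof (intro sum.cong refl)
    fix t :: 'a
    show "card {x \<in> ?N. h (x + t *s u) (x + t *s u) = 0} = card {x \<in> V. h x u \<noteq> 0 \<and> h x x = 0}"
    proof (rule bij_betw_same_card[OF bij_betwI])
      show "(\<lambda>x. x + t *s u) \<in> {x \<in> ?N. h (x + t *s u) (x + t *s u) = 0} \<rightarrow> {x \<in> V. h x u \<noteq> 0 \<and> h x x = 0}"
        using V u by (auto simp: xu vec.subspace_add vec.subspace_scale)
      show "(\<lambda>x. x - t *s u) \<in> {x \<in> V. h x u \<noteq> 0 \<and> h x x = 0} \<rightarrow> {x \<in> ?N. h (x + t *s u) (x + t *s u) = 0}"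
        using V u xu[of _ "- t"] by (auto simp: vec.subspace_diff vec.subspace_scale)
    qed auto
  qed
  finally show ?thesis by (simp add: card_field mult.commute)
qed

text \<open>Vectors are counted instead of points; each point of the surface accounts for q^2 - 1 of
  them.\<close>

definition isotropic :: "('a ^ 4) set" where "isotropic = {x. x \<noteq> 0 \<and> h x x = 0}"

lemma isotropic_nonempty: "isotropic \<noteq> {}"
proof -
  have "q ^ 6 \<le> card (UNIV :: ('a ^ 4) set)"
    using q_ge_2 by (simp add: card_field power_increasing flip: power_mult)
  then obtain x where "h x x = 0" "\<forall>a. x \<noteq> a *s (0 :: 'a ^ 4)"
    using exists_isotropic[of UNIV 0] by auto
  then show ?thesis by (auto simp: isotropic_def)
qed

text \<open>Fix an isotropic r. If x is not orthogonal to r, the line x + t r carries exactly q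
  isotropic vectors, more than the degree allows as zeros, so g would vanish at x. Then g times the
  linear form of r vanishes everywhere, against \<open>form_mult_nonzero\<close>.\<close>

lemma form_not_vanishing_on_isotropic:
  assumes g: "form e g" "g y \<noteq> 0" and e: "e < q"
  shows "\<exists>x\<in>isotropic. g x \<noteq> 0"
proof (rule ccontr)
  assume "\<not> ?thesis"
  then have vanish: "g x = 0" if "x \<noteq> 0" "h x x = 0" for x using that by (auto simp: isotropic_def)
  obtain r where r: "r \<noteq> 0" "h r r = 0" using isotropic_nonempty by (auto simp: isotropic_def)
  have "g x = 0" if x: "h x r \<noteq> 0" for x
  proof (rule ccontr)
    assume gx: "g x \<noteq> 0"
    have rx: "h r x \<noteq> 0" using x herm_swap_zero[OF hermitian] by blast
    have "{t. h (x + t *s r) (x + t *s r) = 0} \<subseteq> {t. g (x + t *s r) = 0}"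
    proof clarify
      fix t assume t: "h (x + t *s r) (x + t *s r) = 0"
      have "h (x + t *s r) r \<noteq> 0" using x r by (simp add: herm_add_left herm_scale_left)
      then have "x + t *s r \<noteq> 0" by auto
      then show "g (x + t *s r) = 0" using t vanish by blast
    qed
    then have "card {t. h (x + t *s r) (x + t *s r) = 0} \<le> card {t. g (x + t *s r) = 0}"
      by (intro card_mono) auto
    also have "\<dots> \<le> e" using gx by (intro form_line_roots[OF g(1), where s = 0]) simp
    finally show False using herm_trace_solution[OF hermitian r(2) rx] e by simp
  qed
  then have "g x * h x r = 0" for x by (cases "h x r = 0") auto
  moreover obtain z where z: "h z r \<noteq> 0" using nondegenerate_left[OF r(1)] by blast
  have "2 * q \<le> q\<^sup>2" using q_ge_2 by (simp add: power2_eq_square)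
  then have "e + 1 + 1 < CARD('a)" using e q_ge_2 by (simp add: card_field)
  ultimately show False using form_mult_nonzero[OF g form_herm z] by blast
qed

end

section \<open>The neighbourhood of a generator and the gain from its planes\<close>

context hermitian_surface
begin

lemma card_orth_UNIV:
  assumes "u \<noteq> 0"
  shows "card {x. h x u = 0} = q ^ 6"
proof -
  obtain y where "h y u \<noteq> 0" using nondegenerate_left[OF assms] by blast
  then have "q\<^sup>2 * q ^ 6 = q\<^sup>2 * card {x. h x u = 0}"
    using card_orth_eq[of UNIV y u] by (simp add: card_field flip: power_mult power_add)
  then show ?thesis using q_ge_2 by (subst (asm) nat_mult_eq_cancel1) auto
qed

text \<open>Otherwise pairing with u1 vanishes wherever pairing with u0 does, so the two functionals
  are proportional, and nondegeneracy makes u1 a multiple of u0.\<close>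

lemma card_orth2:
  assumes "u0 \<noteq> 0" "\<forall>a. u1 \<noteq> a *s u0"
  shows "card {x. h x u0 = 0 \<and> h x u1 = 0} = q ^ 4"
proof -
  have sub: "vec.subspace {x. h x u0 = 0}" using subspace_orth[of UNIV u0] by simp
  obtain z where z: "h z u0 \<noteq> 0" using nondegenerate_left[OF assms(1)] by blast
  have "\<exists>y. h y u0 = 0 \<and> h y u1 \<noteq> 0"
  proof (rule ccontr)
    assume *: "\<not> ?thesis"
    \<comment> \<open>The form is semilinear in its second argument, so the factor of
      \<open>u0\<close> is a q-th root of the ratio; its q-th power is such a root.\<close>
    obtain a where a: "a ^ q = h z u1 / h z u0" using power_q_q[of "h z u1 / h z u0"] by blast
    have "h y (u1 - a *s u0) = 0" for y
    proof -
      have "h (y - (h y u0 / h z u0) *s z) u0 + h y u0 = h y u0"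
        using herm_add_left[of q U "y - (h y u0 / h z u0) *s z" "(h y u0 / h z u0) *s z" u0] z
        by (simp add: herm_scale_left)
      then have "h (y - (h y u0 / h z u0) *s z) u1 = 0" using * by auto
      then have "h y u1 = h y u0 / h z u0 * h z u1"
        using herm_add_left[of q U "y - (h y u0 / h z u0) *s z" "(h y u0 / h z u0) *s z" u1]
        by (simp add: herm_scale_left)
      moreover have "h y (u1 - a *s u0) = h y u1 - a ^ q * h y u0"
        using herm_add_right[of U y "u1 - a *s u0" "a *s u0"] by (simp add: herm_scale_right)
      ultimately show ?thesis by (simp add: a)
    qed
    then have "u1 - a *s u0 = 0" using nondegenerate_left by blast
    then show False using assms(2) by simp
  qed
  then obtain y where "h y u0 = 0" "h y u1 \<noteq> 0" by blast
  then have "q\<^sup>2 * q ^ 4 = q\<^sup>2 * card {x. h x u0 = 0 \<and> h x u1 = 0}"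
    using card_orth_eq[OF sub, of y u1] card_orth_UNIV[OF assms(1)] by (simp flip: power_add)
  then show ?thesis using q_ge_2 by (subst (asm) nat_mult_eq_cancel1) auto
qed

text \<open>The isotropic vectors are sorted by their position relative to the generator of u0 and
  u1: there are q^7 - q^5 in \<open>A\<close>, q^5 - q^3 in \<open>B\<close>, and the q^4 vectors of
  \<open>C\<close> are all counted, including 0.\<close>

lemma card_isotropic_le:
  assumes u0: "u0 \<noteq> 0" "h u0 u0 = 0" and u1: "h u1 u1 = 0" "h u1 u0 = 0" "\<forall>a. u1 \<noteq> a *s u0"
  shows "card isotropic + 1 + q ^ 3 \<le> q ^ 7 + q ^ 4"
proof -
  define A where "A = {x. h x u0 \<noteq> 0 \<and> h x x = 0}"
  define B where "B = {x. h x u0 = 0 \<and> h x u1 \<noteq> 0 \<and> h x x = 0}"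
  define C where "C = {x. h x u0 = 0 \<and> h x u1 = 0}"
  have sub: "vec.subspace {x. h x u0 = 0}" using subspace_orth[of UNIV u0] by simp
  have cC: "card C = q ^ 4" unfolding C_def by (rule card_orth2[OF u0(1) u1(3)])
  have "{x. h x u0 \<noteq> 0} \<union> {x. h x u0 = 0} = UNIV" by auto
  then have "card {x. h x u0 \<noteq> 0} + card {x. h x u0 = 0} = card (UNIV :: ('a ^ 4) set)"
    by (subst card_Un_disjoint[symmetric]) auto
  then have 1: "card {x. h x u0 \<noteq> 0} + q ^ 6 = q ^ 8"
    by (simp add: card_orth_UNIV[OF u0(1)] card_field flip: power_mult)
  have "q\<^sup>2 * card A + q * q ^ 6 = q\<^sup>2 * q ^ 7"
  proof -
    have "q\<^sup>2 * card A = q * card {x. h x u0 \<noteq> 0}"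
      using card_isotropic_not_orth[of UNIV u0] u0 by (simp add: A_def)
    then have "q\<^sup>2 * card A + q * q ^ 6 = q * (card {x. h x u0 \<noteq> 0} + q ^ 6)"
      by (simp add: distrib_left)
    then show ?thesis unfolding 1 by (simp add: eval_nat_numeral)
  qed
  then have "q\<^sup>2 * (card A + q ^ 5) = q\<^sup>2 * q ^ 7" by (simp add: eval_nat_numeral algebra_simps)
  then have cA: "card A + q ^ 5 = q ^ 7" using q_ge_2 by (subst (asm) nat_mult_eq_cancel1) auto
  have "card {x. h x u0 = 0 \<and> h x u1 \<noteq> 0} + card C = card {x. h x u0 = 0}"
    unfolding C_def by (subst card_Un_disjoint[symmetric]) (auto intro: arg_cong[where f = card])
  then have 2: "card {x. h x u0 = 0 \<and> h x u1 \<noteq> 0} + q ^ 4 = q ^ 6"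
    by (simp add: card_orth_UNIV[OF u0(1)] cC)
  have "q\<^sup>2 * card B + q * q ^ 4 = q\<^sup>2 * q ^ 5"
  proof -
    have "q\<^sup>2 * card B = q * card {x. h x u0 = 0 \<and> h x u1 \<noteq> 0}"
      using card_isotropic_not_orth[OF sub, of u1] u1 by (simp add: B_def)
    then have "q\<^sup>2 * card B + q * q ^ 4 = q * (card {x. h x u0 = 0 \<and> h x u1 \<noteq> 0} + q ^ 4)"
      by (simp add: distrib_left)
    then show ?thesis unfolding 2 by (simp add: eval_nat_numeral)
  qed
  then have "q\<^sup>2 * (card B + q ^ 3) = q\<^sup>2 * q ^ 5" by (simp add: eval_nat_numeral algebra_simps)
  then have cB: "card B + q ^ 3 = q ^ 5" using q_ge_2 by (subst (asm) nat_mult_eq_cancel1) auto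
  have "card isotropic + 1 = card (insert 0 isotropic)"
    by (simp add: isotropic_def)
  also have "\<dots> \<le> card (A \<union> (B \<union> C))"
    by (intro card_mono) (auto simp: isotropic_def A_def B_def C_def)
  also have "\<dots> \<le> card A + (card B + card C)"
    by (intro order_trans[OF card_Un_le] add_left_mono card_Un_le)
  finally show ?thesis using cA cB cC by linarith
qed

text \<open>The degree k that g lacks is spent on planes through a generator. The generator starts
  from an isotropic \<open>u0\<close> with \<open>g u0\<close> nonzero, which keeps
  \<open>T0\<close> large, and \<open>u1\<close> completes it.\<close>

lemma gain:
  assumes g: "form e g" "g y \<noteq> 0" and k: "k \<ge> 1" "e + k \<le> q - 1"
  shows "\<exists>g' y'. form (e + k) g' \<and> g' y' \<noteq> 0 \<and>
    q\<^sup>2 * card {x \<in> isotropic. g x = 0} + k * card {x \<in> isotropic. g x \<noteq> 0} <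
    q\<^sup>2 * card {x \<in> isotropic. g' x = 0}"
proof -
  have eq: "e < q" using k by simp
  obtain u0 where u0: "u0 \<noteq> 0" "h u0 u0 = 0" "g u0 \<noteq> 0"
    using form_not_vanishing_on_isotropic[OF g eq] by (auto simp: isotropic_def)
  have sub: "vec.subspace {x. h x u0 = 0}" using subspace_orth[of UNIV u0] by simp
  obtain u1 where u1: "h u1 u1 = 0" "h u1 u0 = 0" "\<forall>a. u1 \<noteq> a *s u0"
    using exists_isotropic[OF sub _, of u0] unfolding card_orth_UNIV[OF u0(1)] mem_Collect_eq by blast
  have u01: "h u0 u1 = 0" using herm_swap_zero[OF hermitian u1(2)] .
  have u1_0: "u1 \<noteq> 0" using u1(3)[rule_format, of 0] by auto
  \<comment> \<open>\<open>T\<close> collects the missing vectors and \<open>T0\<close> those on the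
    generator, which is its own orthogonal complement.\<close>
  define T where "T = {x \<in> isotropic. g x \<noteq> 0}"
  define T0 where "T0 = {x \<in> T. h x u0 = 0 \<and> h x u1 = 0}"
  \<comment> \<open>The zero sets of \<open>h x (w a)\<close> are the \<open>q\<^sup>2 + 1\<close> planes through the generator spanned by \<open>u0\<close>
    and \<open>u1\<close>, indexed by the projective line.\<close>
  define w where "w a = (case a of None \<Rightarrow> u1 | Some t \<Rightarrow> u0 + t ^ q *s u1)" for a
  define P where "P a = {x \<in> T - T0. h x (w a) = 0}" for a
  \<comment> \<open>The exponent q in \<open>w\<close> is undone by semilinearity, so the planes
    form the pencil \<open>h x u0 + t * h x u1\<close> together with \<open>h x u1\<close>.\<close>
  have w_None: "h x (w None) = h x u1" and w_Some: "h x (w (Some t)) = h x u0 + t * h x u1" for x t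
    by (auto simp: w_def herm_add_right herm_scale_right)
  have w_nz: "w a \<noteq> 0" for a
  proof (cases a)
    case None
    then show ?thesis using u1_0 by (simp add: w_def)
  next
    case (Some t)
    have "u0 + t ^ q *s u1 \<noteq> 0"
    proof
      assume *: "u0 + t ^ q *s u1 = 0"
      show False
      proof (cases "t ^ q = 0")
        case False
        have "u1 = inverse (t ^ q) *s (t ^ q *s u1)" using False by simp
        also have "t ^ q *s u1 = - u0" using * by (simp add: eq_neg_iff_add_eq_0 add.commute)
        also have "inverse (t ^ q) *s - u0 = (- inverse (t ^ q)) *s u0" by simp
        finally show False using u1(3) by blast
      next
        case True
        from * have "u0 = 0" unfolding True by simp
        with u0(1) show False by simp
      qed
    qed
    then show ?thesis using Some by (simp add: w_def)
  qed
  have ex1: "\<exists>a. h x (w a) = 0" for x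
  proof (cases "h x u1 = 0")
    case True
    then show ?thesis by (intro exI[of _ None]) (simp add: w_None)
  next
    case False
    then show ?thesis by (intro exI[of _ "Some (- h x u0 / h x u1)"]) (simp add: w_Some)
  qed
  have uniq: "a = b" if "h x (w a) = 0" "h x (w b) = 0" "h x u0 \<noteq> 0 \<or> h x u1 \<noteq> 0" for x a b
    using that
  proof (cases a; cases b)
    fix s t assume ab: "a = Some s" "b = Some t"
    have "(s - t) * h x u1 = (h x u0 + s * h x u1) - (h x u0 + t * h x u1)"
      by (simp add: algebra_simps)
    also have "\<dots> = 0" using that unfolding ab w_Some by simp
    finally have "(s - t) * h x u1 = 0" .
    moreover have "h x u1 \<noteq> 0" using that unfolding ab w_Some by auto
    ultimately show "a = b" by (simp add: ab)
  qed (use that in \<open>auto simp: w_None w_Some\<close>)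
  have card_UN: "card (\<Union>a\<in>B. P a) = (\<Sum>a\<in>B. card (P a))" for B
    by (rule card_UN_disjoint) (auto simp: P_def T0_def dest: uniq)
  have UN: "(\<Union>a. P a) = T - T0" using ex1 by (auto simp: P_def)
  have cT0: "card (T - T0) = card T - card T0" "card T0 \<le> card T"
    by (auto simp: T0_def card_Diff_subset intro: card_mono)
  have card_opt: "card (UNIV :: 'a option set) = q\<^sup>2 + 1" by (simp add: card_field)
  have "q \<le> q\<^sup>2" using q_ge_2 by (simp add: power2_eq_square)
  then have "k \<le> card (UNIV :: 'a option set)" using k card_opt by simp
  from subset_sum_ge_average[OF finite this, of "\<lambda>a. card (P a)"]
  obtain B where "card B = k" "k * (\<Sum>a\<in>UNIV. card (P a)) \<le> (q\<^sup>2 + 1) * (\<Sum>a\<in>B. card (P a))"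
    unfolding card_opt by blast
  then have B: "card B = k" "k * card (T - T0) \<le> (q\<^sup>2 + 1) * (\<Sum>a\<in>B. card (P a))"
    unfolding UN[symmetric] card_UN by auto
  define g' where "g' x = g x * (\<Prod>a\<in>B. h x (w a))" for x
  have small: "e + card B + 1 < CARD('a)"
  proof -
    have "2 * q \<le> q\<^sup>2" using q_ge_2 by (simp add: power2_eq_square)
    then show ?thesis using k B(1) q_ge_2 by (simp add: card_field)
  qed
  have g': "form (e + k) g' \<and> (\<exists>x. g' x \<noteq> 0)"
    unfolding g'_def B(1)[symmetric] using g
    by (intro form_prod_nonzero small form_herm nondegenerate_left w_nz) auto
  have zeros: "card {x \<in> isotropic. g x = 0} + (card T0 + (\<Sum>a\<in>B. card (P a))) \<le>
      card {x \<in> isotropic. g' x = 0}"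
  proof -
    \<comment> \<open>Here k >= 1 matters: at least one plane is needed for the vectors of
      \<open>T0\<close> to become zeros of \<open>g'\<close>.\<close>
    have "B \<noteq> {}" using B(1) k(1) by auto
    then obtain b where b: "b \<in> B" by blast
    have "h x (w b) = 0" if "x \<in> T0" for x
      using that by (cases b) (auto simp: T0_def w_None w_Some)
    then have "{x \<in> isotropic. g x = 0} \<union> (T0 \<union> (\<Union>a\<in>B. P a)) \<subseteq> {x \<in> isotropic. g' x = 0}"
      using b by (auto simp: g'_def P_def T_def T0_def)
    then have "card ({x \<in> isotropic. g x = 0} \<union> (T0 \<union> (\<Union>a\<in>B. P a))) \<le> card {x \<in> isotropic. g' x = 0}"
      by (intro card_mono) auto
    also have "card ({x \<in> isotropic. g x = 0} \<union> (T0 \<union> (\<Union>a\<in>B. P a))) =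
        card {x \<in> isotropic. g x = 0} + card (T0 \<union> (\<Union>a\<in>B. P a))"
      by (rule card_Un_disjoint) (auto simp: P_def T_def T0_def)
    also have "card (T0 \<union> (\<Union>a\<in>B. P a)) = card T0 + card (\<Union>a\<in>B. P a)"
      by (rule card_Un_disjoint) (auto simp: P_def)
    finally show ?thesis by (simp only: card_UN)
  qed
  \<comment> \<open>Of the q^2 points u0 + t u1 of the generator at most e are zeros of g, since t =
    0 is none; each of the others has q^2 - 1 nonzero multiples.\<close>
  have "(q\<^sup>2 - 1) * (q\<^sup>2 - e) \<le> card T0"
  proof -
    let ?G = "{t. g (u0 + t *s u1) \<noteq> 0}"
    have "card {t. g (u0 + t *s u1) = 0} \<le> e"
      using u0(3) by (intro form_line_roots[OF g(1), where s = 0]) simp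
    moreover have "card {t. g (u0 + t *s u1) = 0} + card ?G = q\<^sup>2"
      unfolding card_field[symmetric]
      by (subst card_Un_disjoint[symmetric]) (auto intro: arg_cong[where f = card])
    ultimately have "(q\<^sup>2 - 1) * (q\<^sup>2 - e) \<le> (q\<^sup>2 - 1) * card ?G"
      by (intro mult_le_mono2) linarith
    moreover have "card ((UNIV - {0::'a}) \<times> ?G) = (q\<^sup>2 - 1) * card ?G"
      unfolding card_cartesian_product by (simp add: card_Diff_singleton card_field)
    moreover have "card ((UNIV - {0::'a}) \<times> ?G) \<le> card T0"
    proof (rule card_inj_on_le)
      let ?\<phi> = "\<lambda>(a :: 'a, t). a *s (u0 + t *s u1)"
      have inj: "a = b \<and> s = t" if *: "a *s (u0 + s *s u1) = b *s (u0 + t *s u1)" "a \<noteq> 0" for a b s t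
      proof -
        have eq: "(b - a) *s u0 = (a * s - b * t) *s u1"
          using * by (simp add: vec.scale_right_distrib vec.scale_left_diff_distrib algebra_simps)
        have z: "a * s - b * t = 0"
        proof (rule ccontr)
          assume nz: "a * s - b * t \<noteq> 0"
          have "u1 = inverse c *s (c *s u1)" if "c \<noteq> 0" for c using that by simp
          from this[OF nz] have "u1 = inverse (a * s - b * t) *s ((b - a) *s u0)" unfolding eq .
          then have "u1 = (inverse (a * s - b * t) * (b - a)) *s u0" by (simp only: vector_smult_assoc)
          then show False using u1(3) by blast
        qed
        with eq u0(1) have "b = a" by simp
        with z \<open>a \<noteq> 0\<close> show ?thesis by simp
      qed
      then show "inj_on ?\<phi> ((UNIV - {0}) \<times> ?G)" by (auto simp: inj_on_def)
      show "?\<phi> ` ((UNIV - {0}) \<times> ?G) \<subseteq> T0"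
      proof
        fix x assume "x \<in> ?\<phi> ` ((UNIV - {0}) \<times> ?G)"
        then obtain a t where x: "x = a *s (u0 + t *s u1)" and a: "a \<noteq> 0" and t: "g (u0 + t *s u1) \<noteq> 0"
          by auto
        have "g (a *s (u0 + t *s u1)) \<noteq> 0" using a t unfolding form_homogeneous[OF g(1)] by simp
        moreover have "a *s (u0 + t *s u1) \<noteq> 0" using inj[of a t 0 0] a by auto
        ultimately show "x \<in> T0"
          by (simp add: x T0_def T_def isotropic_def herm_add_left herm_add_right herm_scale_left
            herm_scale_right u0(2) u1 u01)
      qed
    qed simp
    ultimately show ?thesis by linarith
  qed
  moreover have "card T + 1 + q ^ 3 \<le> q ^ 7 + q ^ 4"
  proof -
    have "card T \<le> card isotropic" by (auto simp: T_def intro: card_mono)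
    then show ?thesis using card_isotropic_le[OF u0(1,2) u1] by linarith
  qed
  ultimately have "k * card T < q\<^sup>2 * (card T0 + (\<Sum>a\<in>B. card (P a)))"
    using B(2) cT0 k by (intro gain_inequality[OF q_ge_2]) auto
  moreover have "q\<^sup>2 * (card {x \<in> isotropic. g x = 0} + (card T0 + (\<Sum>a\<in>B. card (P a)))) \<le>
      q\<^sup>2 * card {x \<in> isotropic. g' x = 0}"
    using zeros by (rule mult_le_mono2)
  ultimately have "q\<^sup>2 * card {x \<in> isotropic. g x = 0} + k * card T < q\<^sup>2 * card {x \<in> isotropic. g' x = 0}"
    by (simp add: distrib_left)
  then show ?thesis using g' by (auto simp: T_def)
qed

end

section \<open>Rational points and lines\<close>

definition monomial :: "('n::finite \<Rightarrow>\<^sub>0 nat) \<Rightarrow> 'a::comm_ring_1 ^ 'n \<Rightarrow> 'a" where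
  "monomial m v = (\<Prod>i\<in>UNIV. (v $ i) ^ Poly_Mapping.lookup m i)"

definition rational_eval :: "('a::field, 'n::finite) mpoly \<Rightarrow> 'a ^ 'n \<Rightarrow> 'a" where
  "rational_eval F v = (\<Sum>m\<in>Poly_Mapping.keys F. Poly_Mapping.lookup F m * monomial m v)"

definition to_ac_vec :: "'a::field ^ 'n::finite \<Rightarrow> 'a alg_closure ^ 'n" where
  "to_ac_vec v = (\<chi> i. to_ac (v $ i))"

definition proj_point :: "'a::field ^ 'n::finite \<Rightarrow> ('a, 'n) point" where
  "proj_point v = vec.span {to_ac_vec v}"

lemma to_ac_vec_nth [simp]: "to_ac_vec v $ i = to_ac (v $ i)"
  by (simp add: to_ac_vec_def)

lemma to_ac_vec_add: "to_ac_vec (v + w) = to_ac_vec v + to_ac_vec w"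
  by (simp add: vec_eq_iff)

lemma to_ac_vec_scale: "to_ac_vec (c *s v) = to_ac c *s to_ac_vec v"
  by (simp add: vec_eq_iff)

lemma to_ac_vec_eq_iff [simp]: "to_ac_vec v = to_ac_vec w \<longleftrightarrow> v = w"
  by (simp add: vec_eq_iff)

lemma to_ac_vec_eq_0_iff [simp]: "to_ac_vec v = 0 \<longleftrightarrow> v = 0"
  by (simp add: vec_eq_iff)

lemma poly_eval_to_ac: "poly_eval F (to_ac_vec v) = to_ac (rational_eval F v)"
  by (simp add: poly_eval_def rational_eval_def monomial_def to_ac_sum to_ac_prod)

lemma poly_eval_scale:
  assumes "homogeneous d F"
  shows "poly_eval F (c *s x) = c ^ d * poly_eval F x"
proof -
  have "(\<Prod>i\<in>UNIV. ((c *s x) $ i) ^ Poly_Mapping.lookup m i) =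
      c ^ d * (\<Prod>i\<in>UNIV. (x $ i) ^ Poly_Mapping.lookup m i)" if "m \<in> Poly_Mapping.keys F" for m
    using assms that by (simp add: homogeneous_def power_mult_distrib prod.distrib flip: power_sum)
  then show ?thesis by (simp add: poly_eval_def sum_distrib_left mult_ac)
qed

lemma form_monomial:
  "form (\<Sum>i\<in>UNIV. Poly_Mapping.lookup m i) (monomial m :: 'a::comm_ring_1 ^ 'n::finite \<Rightarrow> 'a)"
proof -
  have "form (\<Sum>i\<in>I. Poly_Mapping.lookup m i) (\<lambda>v :: 'a ^ 'n. \<Prod>i\<in>I. (v $ i) ^ Poly_Mapping.lookup m i)"
    if "finite I" for I
    using that
  proof (induction I rule: finite_induct)
    case (insert i I)
    from form_mult[OF form_power[OF form_coordinate] insert.IH] insert.hyps show ?case by simp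
  qed (simp add: form.const)
  then show ?thesis by (simp add: monomial_def [abs_def])
qed

lemma form_rational_eval:
  fixes F :: "('a::field, 'n::finite) mpoly"
  assumes "homogeneous d F"
  shows "form d (rational_eval F)"
  unfolding rational_eval_def [abs_def]
proof (intro form_sum form_scale)
  fix m assume "m \<in> Poly_Mapping.keys F"
  with assms form_monomial[of m] show "form d (monomial m :: 'a ^ 'n \<Rightarrow> 'a)"
    by (simp add: homogeneous_def)
qed

lemma monomial_add_single: "monomial (m + Poly_Mapping.single i 1) v = v $ i * monomial m v"
proof -
  have "(\<Prod>j\<in>UNIV. (v $ j) ^ Poly_Mapping.lookup (Poly_Mapping.single i 1) j) = v $ i"
    by (subst prod.remove[of _ i]) (auto simp: lookup_single intro!: prod.neutral)
  then show ?thesis by (simp add: monomial_def lookup_add power_add prod.distrib mult.commute)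
qed

lemma form_imp_sum_monomials:
  fixes f :: "'a::comm_ring_1 ^ 'n::finite \<Rightarrow> 'a"
  assumes "form d f"
  shows "\<exists>S c. finite S \<and> (\<forall>m\<in>S. (\<Sum>i\<in>UNIV. Poly_Mapping.lookup m i) = d) \<and>
    f = (\<lambda>v. \<Sum>m\<in>S. c m * monomial m v)"
  using assms
proof (induction rule: form.induct)
  case (const c)
  show ?case by (intro exI[of _ "{0}"] exI[of _ "\<lambda>_. c"]) (simp add: monomial_def)
next
  case (add d f g)
  then obtain S c T b where S: "finite S" "\<forall>m\<in>S. (\<Sum>i\<in>UNIV. Poly_Mapping.lookup m i) = d"
      "f = (\<lambda>v. \<Sum>m\<in>S. c m * monomial m v)"
    and T: "finite T" "\<forall>m\<in>T. (\<Sum>i\<in>UNIV. Poly_Mapping.lookup m i) = d"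
      "g = (\<lambda>v. \<Sum>m\<in>T. b m * monomial m v)" by blast
  have "(\<Sum>m\<in>S \<union> T. ((if m \<in> S then c m else 0) + (if m \<in> T then b m else 0)) * monomial m v) =
      f v + g v" for v
  proof -
    have "(\<Sum>m\<in>S \<union> T. (if m \<in> S then c m else 0) * monomial m v) = f v"
      unfolding S(3) using S(1) T(1) by (intro sum.mono_neutral_cong_right) auto
    moreover have "(\<Sum>m\<in>S \<union> T. (if m \<in> T then b m else 0) * monomial m v) = g v"
      unfolding T(3) using S(1) T(1) by (intro sum.mono_neutral_cong_right) auto
    ultimately show ?thesis by (simp add: distrib_right sum.distrib)
  qed
  then show ?case using S T
    by (intro exI[of _ "S \<union> T"] exI[of _ "\<lambda>m. (if m \<in> S then c m else 0) + (if m \<in> T then b m else 0)"]) auto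
next
  case (coord d f i)
  then obtain S c where S: "finite S" "\<forall>m\<in>S. (\<Sum>i\<in>UNIV. Poly_Mapping.lookup m i) = d"
      "f = (\<lambda>v. \<Sum>m\<in>S. c m * monomial m v)" by blast
  let ?e = "Poly_Mapping.single i 1 :: 'n \<Rightarrow>\<^sub>0 nat"
  have "(\<Sum>j\<in>UNIV. Poly_Mapping.lookup ?e j) = 1"
    by (subst sum.remove[of _ i]) (auto simp: lookup_single intro!: sum.neutral)
  then have "\<forall>m\<in>(\<lambda>m. m + ?e) ` S. (\<Sum>i\<in>UNIV. Poly_Mapping.lookup m i) = Suc d"
    using S(2) by (auto simp: lookup_add sum.distrib)
  \<comment> \<open>Adding \<open>?e\<close> is injective on exponents, so the coefficient at a
    shifted exponent is read off at \<open>m - ?e\<close>.\<close>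
  moreover have "(\<Sum>m\<in>(\<lambda>m. m + ?e) ` S. c (m - ?e) * monomial m v) = v $ i * f v" for v
    by (subst sum.reindex)
      (auto simp: inj_on_def monomial_add_single [unfolded One_nat_def] S(3) sum_distrib_left mult_ac)
  ultimately show ?case using S(1)
    by (intro exI[of _ "(\<lambda>m. m + ?e) ` S"] exI[of _ "\<lambda>m. c (m - ?e)"]) auto
qed

text \<open>\<open>M3\<close> is a maximum over formal polynomials; this admits a form that is only
  known as a function.\<close>

lemma form_imp_rational_eval:
  assumes "form d (f :: 'a::field ^ 'n::finite \<Rightarrow> 'a)"
  shows "\<exists>F. homogeneous d F \<and> rational_eval F = f"
proof -
  obtain S c where S: "finite S" "\<forall>m\<in>S. (\<Sum>i\<in>UNIV. Poly_Mapping.lookup m i) = d"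
      "f = (\<lambda>v. \<Sum>m\<in>S. c m * monomial m v)"
    using form_imp_sum_monomials[OF assms] by blast
  define F where "F = Abs_poly_mapping (\<lambda>m. if m \<in> S then c m else 0)"
  have F: "Poly_Mapping.lookup F m = (if m \<in> S then c m else 0)" for m
    using S(1) unfolding F_def by (subst Abs_poly_mapping_inverse) (auto elim: rev_finite_subset)
  have keys: "Poly_Mapping.keys F \<subseteq> S" by (auto simp: F in_keys_iff split: if_splits)
  have "rational_eval F v = f v" for v
    unfolding rational_eval_def S(3) using S(1) keys
    by (intro sum.mono_neutral_cong_left) (auto simp: F in_keys_iff)
  moreover have "homogeneous d F" using keys S(2) by (auto simp: homogeneous_def)
  ultimately show ?thesis by blast
qed

text \<open>With the other variables fixed, the sum is a polynomial in \<open>v j\<close> of degree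
  below the field size that vanishes everywhere, so each of its coefficients vanishes. Such a
  coefficient is a sum of the same kind in fewer variables, over the exponents that agree at j. The
  exponents are separated by I, so one at most is left in the end.\<close>

lemma vanishing_sum_monomials:
  fixes c :: "('n \<Rightarrow>\<^sub>0 nat) \<Rightarrow> 'a::{field,finite}"
  assumes "finite I" "finite S" "\<And>m i. m \<in> S \<Longrightarrow> i \<in> I \<Longrightarrow> Poly_Mapping.lookup m i < CARD('a)"
    and "\<And>m m'. m \<in> S \<Longrightarrow> m' \<in> S \<Longrightarrow> (\<forall>i\<in>I. Poly_Mapping.lookup m i = Poly_Mapping.lookup m' i) \<Longrightarrow> m = m'"
    and "\<And>v. (\<Sum>m\<in>S. c m * (\<Prod>i\<in>I. v i ^ Poly_Mapping.lookup m i)) = 0"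
    and "m \<in> S"
  shows "c m = 0"
  using assms
proof (induction I arbitrary: S m rule: finite_induct)
  case empty
  then have "S = {m}" by auto
  with empty.prems(4) show ?case by simp
next
  case (insert j I)
  let ?T = "{m' \<in> S. Poly_Mapping.lookup m' j = Poly_Mapping.lookup m j}"
  have "c m = 0" if "(\<forall>v. (\<Sum>m\<in>?T. c m * (\<Prod>i\<in>I. v i ^ Poly_Mapping.lookup m i)) = 0)"
  proof (rule insert.IH[of ?T])
    show "m1 = m2" if "m1 \<in> ?T" "m2 \<in> ?T" "\<forall>i\<in>I. Poly_Mapping.lookup m1 i = Poly_Mapping.lookup m2 i" for m1 m2
      using that by (intro insert.prems(3)) auto
  qed (use that insert.prems in auto)
  moreover have "(\<Sum>m\<in>?T. c m * (\<Prod>i\<in>I. v i ^ Poly_Mapping.lookup m i)) = 0" for v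
  proof -
    let ?b = "\<lambda>m. c m * (\<Prod>i\<in>I. v i ^ Poly_Mapping.lookup m i)"
    define P where "P = (\<Sum>m\<in>S. Polynomial.monom (?b m) (Poly_Mapping.lookup m j))"
    have "poly P x = 0" for x
    proof -
      have "(\<Prod>i\<in>I. (v(j := x)) i ^ Poly_Mapping.lookup m i) = (\<Prod>i\<in>I. v i ^ Poly_Mapping.lookup m i)" for m :: "'n \<Rightarrow>\<^sub>0 nat"
        using insert.hyps by (intro prod.cong) auto
      then show ?thesis
        using insert.prems(4)[of "v(j := x)"] insert.hyps
        by (simp add: P_def poly_sum Polynomial.poly_monom mult_ac)
    qed
    moreover have "Poly_Mapping.lookup m' j \<le> CARD('a) - 1" if "m' \<in> S" for m'
      using insert.prems(2)[OF that, of j] by simp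
    then have "Polynomial.degree P \<le> CARD('a) - 1"
      unfolding P_def using insert.prems(1)
      by (intro degree_sum_le order_trans[OF Polynomial.degree_monom_le])
    ultimately have "P = 0"
      using poly_roots_card_le[of P "CARD('a) - 1"] zero_less_card_finite[where 'a = 'a]
      by (cases "P = 0") (simp_all del: zero_less_card_finite)
    then have "0 = Polynomial.coeff P (Poly_Mapping.lookup m j)" by simp
    also have "\<dots> = (\<Sum>m'\<in>S. if Poly_Mapping.lookup m' j = Poly_Mapping.lookup m j then ?b m' else 0)"
      unfolding P_def Polynomial.coeff_sum by (intro sum.cong) auto
    also have "\<dots> = sum ?b ?T" using insert.prems(1) by (simp add: sum.inter_filter)
    finally show ?thesis by simp
  qed
  ultimately show ?case by blast
qed

text \<open>No exponent exceeds the degree, so all stay below the field size, where values determine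
  the coefficients.\<close>

lemma rational_eval_nonzero:
  fixes F :: "('a::{field,finite}, 'n::finite) mpoly"
  assumes "F \<noteq> 0" "homogeneous d F" "d < CARD('a)"
  shows "\<exists>v. rational_eval F v \<noteq> 0"
proof (rule ccontr)
  assume "\<not> ?thesis"
  then have vanish: "rational_eval F v = 0" for v by blast
  have "Poly_Mapping.lookup F m = 0" if m: "m \<in> Poly_Mapping.keys F" for m
  proof (rule vanishing_sum_monomials[of UNIV "Poly_Mapping.keys F"])
    fix m' i assume "m' \<in> Poly_Mapping.keys F"
    then have "(\<Sum>i\<in>UNIV. Poly_Mapping.lookup m' i) = d" using assms(2) by (simp add: homogeneous_def)
    then have "Poly_Mapping.lookup m' i \<le> d" using member_le_sum[of i UNIV "Poly_Mapping.lookup m'"] by simp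
    then show "Poly_Mapping.lookup m' i < CARD('a)" using assms(3) by simp
  next
    show "(\<Sum>m\<in>Poly_Mapping.keys F. Poly_Mapping.lookup F m * (\<Prod>i\<in>UNIV. v i ^ Poly_Mapping.lookup m i)) = 0" for v
      using vanish[of "\<chi> i. v i"] by (simp add: rational_eval_def monomial_def)
  qed (use m in \<open>auto intro: poly_mapping_eqI\<close>)
  then have "F = 0" by (intro poly_mapping_eqI) (metis in_keys_iff lookup_zero)
  then show False using assms(1) by simp
qed

section \<open>Points and lines in base field coordinates\<close>

lemma proj_point_eq_range: "proj_point v = range (\<lambda>c. c *s to_ac_vec v)"
  by (simp add: proj_point_def vec.span_singleton)

lemma proj_point_in_proj_space: "v \<noteq> 0 \<Longrightarrow> proj_point v \<in> proj_space"
  by (auto simp: proj_space_def proj_point_def intro!: exI[of _ "to_ac_vec v"])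

lemma rational_point_iff: "rational_point P \<longleftrightarrow> (\<exists>v. v \<noteq> 0 \<and> P = proj_point v)"
  by (simp add: rational_point_def proj_point_def to_ac_vec_def)

lemma proj_point_scale:
  assumes "c \<noteq> 0"
  shows "proj_point (c *s v) = proj_point v"
proof -
  have "to_ac_vec v = inverse (to_ac c) *s to_ac_vec (c *s v)"
    using assms by (simp add: to_ac_vec_scale)
  then show ?thesis unfolding proj_point_def vec.span_eq
    by (metis empty_subsetI insert_subset to_ac_vec_scale vec.span_base vec.span_scale singletonI)
qed

text \<open>A scalar of the closure that relates two base field vectors is a quotient of
  coordinates, hence lies in the base field.\<close>

lemma to_ac_vec_multiple:
  assumes "to_ac_vec w = \<gamma> *s to_ac_vec v"
  shows "\<exists>c. w = c *s v"
proof (cases "v = 0")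
  case True
  with assms have "w = 0" by (simp add: vec_eq_iff)
  with True show ?thesis by simp
next
  case False
  then obtain i where i: "v $ i \<noteq> 0" by (auto simp: vec_eq_iff)
  have "to_ac (w $ i) = \<gamma> * to_ac (v $ i)" using assms by (simp add: vec_eq_iff)
  then have "\<gamma> = to_ac (w $ i / v $ i)" using i by (simp add: field_simps)
  with assms have "to_ac_vec w = to_ac_vec ((w $ i / v $ i) *s v)" by (simp only: to_ac_vec_scale)
  then show ?thesis by auto
qed

lemma proj_point_eq_iff:
  assumes "v \<noteq> 0" "w \<noteq> 0"
  shows "proj_point w = proj_point v \<longleftrightarrow> (\<exists>c. c \<noteq> 0 \<and> w = c *s v)"
proof
  assume "proj_point w = proj_point v"
  then have "to_ac_vec w \<in> proj_point v" by (auto simp: proj_point_def intro: vec.span_base)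
  then obtain \<gamma> where "to_ac_vec w = \<gamma> *s to_ac_vec v" by (auto simp: proj_point_eq_range)
  from to_ac_vec_multiple[OF this] obtain c where "w = c *s v" ..
  with assms show "\<exists>c. c \<noteq> 0 \<and> w = c *s v" by auto
qed (auto simp: proj_point_scale)

lemma card_proj_points:
  fixes S :: "('a::{field,finite} ^ 'n::finite) set"
  assumes "\<And>x. x \<in> S \<Longrightarrow> x \<noteq> 0" "\<And>c x. x \<in> S \<Longrightarrow> c \<noteq> 0 \<Longrightarrow> c *s x \<in> S"
  shows "card S = (CARD('a) - 1) * card (proj_point ` S)"
proof (rule card_fibres_eq)
  fix y assume "y \<in> proj_point ` S"
  then obtain v where v: "v \<in> S" "y = proj_point v" by blast
  have v0: "v \<noteq> 0" using v assms(1) by auto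
  have "{x \<in> S. proj_point x = y} = (\<lambda>c. c *s v) ` (UNIV - {0})"
  proof (intro equalityI subsetI)
    fix x assume "x \<in> {x \<in> S. proj_point x = y}"
    with assms(1) v0 show "x \<in> (\<lambda>c. c *s v) ` (UNIV - {0})"
      by (auto simp: v(2) proj_point_eq_iff)
  qed (use v assms(2) in \<open>auto simp: proj_point_scale\<close>)
  also have "card \<dots> = CARD('a) - 1"
    using v0 by (subst card_image) (auto simp: inj_on_def card_Diff_singleton)
  finally show "card {x \<in> S. proj_point x = y} = CARD('a) - 1" .
qed simp

lemma proj_point_in_zero_set:
  assumes "homogeneous d F" "v \<noteq> 0"
  shows "proj_point v \<in> zero_set F \<longleftrightarrow> rational_eval F v = 0"
proof -
  have "(\<forall>x\<in>proj_point v. poly_eval F x = 0) \<longleftrightarrow> (\<forall>c. c ^ d * to_ac (rational_eval F v) = 0)"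
    by (simp add: proj_point_eq_range poly_eval_scale[OF assms(1)] poly_eval_to_ac)
  also have "\<dots> \<longleftrightarrow> rational_eval F v = 0" by (auto dest: spec[of _ 1])
  finally show ?thesis using assms(2) by (simp add: zero_set_def proj_point_in_proj_space)
qed

lemma proj_point_in_hermitian_variety:
  assumes "v \<noteq> 0"
  shows "proj_point v \<in> hermitian_variety q H \<longleftrightarrow> herm q H v v = 0"
proof -
  have "(\<Sum>i\<in>UNIV. \<Sum>j\<in>UNIV. to_ac (H $ i $ j) * (c *s to_ac_vec v) $ i * ((c *s to_ac_vec v) $ j) ^ q) =
      c * c ^ q * to_ac (herm q H v v)" for c
    by (simp add: herm_def to_ac_sum sum_distrib_left power_mult_distrib mult_ac)
  then have "(\<forall>x\<in>proj_point v. (\<Sum>i\<in>UNIV. \<Sum>j\<in>UNIV. to_ac (H $ i $ j) * x $ i * (x $ j) ^ q) = 0) \<longleftrightarrow>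
      (\<forall>c. c * c ^ q * to_ac (herm q H v v) = 0)"
    by (simp add: proj_point_eq_range)
  also have "\<dots> \<longleftrightarrow> herm q H v v = 0" by (auto dest: spec[of _ 1])
  finally show ?thesis using assms by (simp add: hermitian_variety_def proj_point_in_proj_space)
qed

lemma rational_points_hermitian_zero_set:
  assumes "homogeneous d F"
  shows "rational_points (hermitian_variety q H \<inter> zero_set F) =
    proj_point ` {v. v \<noteq> 0 \<and> herm q H v v = 0 \<and> rational_eval F v = 0}"
  using assms by (auto simp: rational_points_def rational_point_iff proj_point_in_zero_set proj_point_in_hermitian_variety)

text \<open>Cramer's rule: independence provides coordinates i and j with a nonzero minor of p and
  y, and solving there expresses both closure scalars by base field entries.\<close>

lemma to_ac_vec_combination:
  assumes "p \<noteq> 0" "\<forall>c. y \<noteq> c *s p" "to_ac_vec z = \<alpha> *s to_ac_vec p + \<beta> *s to_ac_vec y"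
  shows "\<exists>a b. z = a *s p + b *s y"
proof -
  obtain i where i: "p $ i \<noteq> 0" using assms(1) by (auto simp: vec_eq_iff)
  have "y \<noteq> (y $ i / p $ i) *s p" using assms(2) by blast
  then obtain j where "y $ j \<noteq> y $ i / p $ i * p $ j" by (auto simp: vec_eq_iff)
  then have D: "p $ i * y $ j - p $ j * y $ i \<noteq> 0" using i by (simp add: field_simps)
  have z: "to_ac (z $ l) = \<alpha> * to_ac (p $ l) + \<beta> * to_ac (y $ l)" for l
    using assms(3) by (simp add: vec_eq_iff)
  define b where "b = (p $ i * z $ j - p $ j * z $ i) / (p $ i * y $ j - p $ j * y $ i)"
  have "to_ac (p $ i * z $ j - p $ j * z $ i) = \<beta> * to_ac (p $ i * y $ j - p $ j * y $ i)"
    by (simp add: z algebra_simps)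
  moreover have "to_ac (p $ i * y $ j - p $ j * y $ i) \<noteq> 0" unfolding to_ac_eq_0_iff by (rule D)
  ultimately have \<beta>: "\<beta> = to_ac b" unfolding b_def to_ac_divide by (simp add: nonzero_eq_divide_eq del: to_ac_diff)
  have "\<alpha> * to_ac (p $ i) = to_ac (z $ i - b * y $ i)" using z[of i] by (simp add: \<beta>)
  then have \<alpha>: "\<alpha> = to_ac ((z $ i - b * y $ i) / p $ i)" using i by (simp add: field_simps)
  have "to_ac_vec z = to_ac_vec (((z $ i - b * y $ i) / p $ i) *s p + b *s y)"
    unfolding to_ac_vec_add to_ac_vec_scale using assms(3) \<alpha> \<beta> by simp
  then show ?thesis by auto
qed

lemma proj_point_subset_iff:
  assumes "vec.subspace S"
  shows "proj_point v \<subseteq> S \<longleftrightarrow> to_ac_vec v \<in> S"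
proof
  show "proj_point v \<subseteq> S \<Longrightarrow> to_ac_vec v \<in> S"
    unfolding proj_point_def using vec.span_base[of "to_ac_vec v" "{to_ac_vec v}"] by blast
  show "to_ac_vec v \<in> S \<Longrightarrow> proj_point v \<subseteq> S"
    unfolding proj_point_def using assms by (intro vec.span_minimal) simp
qed

lemma span_proj_points: "vec.span (proj_point p \<union> proj_point y) = vec.span {to_ac_vec p, to_ac_vec y}"
proof -
  have "proj_point p \<subseteq> vec.span {to_ac_vec p, to_ac_vec y}" "proj_point y \<subseteq> vec.span {to_ac_vec p, to_ac_vec y}"
    by (simp_all add: proj_point_subset_iff vec.span_base)
  moreover have "to_ac_vec p \<in> proj_point p" "to_ac_vec y \<in> proj_point y"
    by (simp_all add: proj_point_def vec.span_base)
  then have "{to_ac_vec p, to_ac_vec y} \<subseteq> vec.span (proj_point p \<union> proj_point y)"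
    using vec.span_superset[of "proj_point p \<union> proj_point y"] by blast
  ultimately show ?thesis unfolding vec.span_eq by blast
qed

lemma to_ac_vec_in_span2_iff:
  "to_ac_vec z \<in> vec.span {to_ac_vec p, to_ac_vec y} \<longleftrightarrow>
    (\<exists>\<alpha> \<beta>. to_ac_vec z = \<alpha> *s to_ac_vec p + \<beta> *s to_ac_vec y)"
  by (auto simp: vec.span_insert vec.span_singleton eq_diff_eq algebra_simps)

lemma proj_point_in_proj_line:
  assumes "p \<noteq> 0" "\<forall>c. y \<noteq> c *s p" "z \<noteq> 0"
  shows "proj_point z \<in> proj_line (proj_point p) (proj_point y) \<longleftrightarrow> (\<exists>a b. z = a *s p + b *s y)"
proof -
  have "proj_point z \<in> proj_line (proj_point p) (proj_point y) \<longleftrightarrow>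
      to_ac_vec z \<in> vec.span {to_ac_vec p, to_ac_vec y}"
    using assms(3) by (simp add: proj_line_def proj_point_in_proj_space span_proj_points proj_point_subset_iff)
  also have "\<dots> \<longleftrightarrow> (\<exists>a b. z = a *s p + b *s y)"
    unfolding to_ac_vec_in_span2_iff
  proof
    assume "\<exists>\<alpha> \<beta>. to_ac_vec z = \<alpha> *s to_ac_vec p + \<beta> *s to_ac_vec y"
    then show "\<exists>a b. z = a *s p + b *s y" using to_ac_vec_combination[OF assms(1,2)] by blast
  next
    assume "\<exists>a b. z = a *s p + b *s y"
    then show "\<exists>\<alpha> \<beta>. to_ac_vec z = \<alpha> *s to_ac_vec p + \<beta> *s to_ac_vec y"
      by (metis to_ac_vec_add to_ac_vec_scale)
  qed
  finally show ?thesis .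
qed

text \<open>The coefficients of p and z in terms of a and b have a nonzero determinant
  \<open>D\<close>, as z is no multiple of p; inverting it gives equal spans. Lines through p are
  therefore disjoint apart from p as far as rational points are concerned.\<close>

lemma rational_line_eq_proj_line:
  assumes l: "rational_line l" and p: "p \<noteq> 0" "proj_point p \<in> l"
    and z: "\<forall>c. z \<noteq> c *s p" "proj_point z \<in> l"
  shows "l = proj_line (proj_point p) (proj_point z)"
proof -
  obtain a b where ab: "a \<noteq> 0" "b \<noteq> 0" "proj_point a \<noteq> proj_point b"
    "l = proj_line (proj_point a) (proj_point b)"
    using l by (auto simp: rational_line_def rational_point_iff)
  have z0: "z \<noteq> 0" using z(1)[rule_format, of 0] by auto
  have b': "\<forall>c. b \<noteq> c *s a" using ab proj_point_eq_iff[of a b] by (metis vec.scale_zero_left)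
  obtain \<alpha> \<beta> where pab: "p = \<alpha> *s a + \<beta> *s b"
    using p proj_point_in_proj_line[OF ab(1) b' p(1)] ab(4) by blast
  obtain \<gamma> \<delta> where zab: "z = \<gamma> *s a + \<delta> *s b"
    using z(2) proj_point_in_proj_line[OF ab(1) b' z0] ab(4) by blast
  define D where "D = \<alpha> * \<delta> - \<beta> * \<gamma>"
  have eqs: "\<delta> *s p - \<beta> *s z = D *s a" "\<alpha> *s z - \<gamma> *s p = D *s b"
    by (simp_all add: pab zab D_def vec_eq_iff algebra_simps)
  have D0: "D \<noteq> 0"
  proof
    assume "D = 0"
    then have "\<delta> *s p = \<beta> *s z" "\<alpha> *s z = \<gamma> *s p" using eqs by simp_all
    have zp: False if "x *s z = y *s p" "x \<noteq> 0" for x y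
    proof -
      have "z = inverse x *s (x *s z)" using that(2) by simp
      also have "\<dots> = (inverse x * y) *s p" unfolding that(1) by (simp only: vector_smult_assoc)
      finally show False using z(1) by blast
    qed
    have "\<alpha> = 0" "\<beta> = 0" using zp \<open>\<delta> *s p = \<beta> *s z\<close> \<open>\<alpha> *s z = \<gamma> *s p\<close> by metis+
    with pab p(1) show False by simp
  qed
  have "a = inverse D *s (\<delta> *s p - \<beta> *s z)" "b = inverse D *s (\<alpha> *s z - \<gamma> *s p)"
    unfolding eqs using D0 by simp_all
  then have "a = (inverse D * \<delta>) *s p + (- inverse D * \<beta>) *s z"
    "b = (- inverse D * \<gamma>) *s p + (inverse D * \<alpha>) *s z"
    by (simp_all add: vec_eq_iff algebra_simps)
  then have "to_ac_vec a \<in> vec.span {to_ac_vec p, to_ac_vec z}"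
    "to_ac_vec b \<in> vec.span {to_ac_vec p, to_ac_vec z}"
    unfolding to_ac_vec_in_span2_iff by (metis to_ac_vec_add to_ac_vec_scale)+
  moreover have "to_ac_vec p \<in> vec.span {to_ac_vec a, to_ac_vec b}"
    "to_ac_vec z \<in> vec.span {to_ac_vec a, to_ac_vec b}"
    unfolding to_ac_vec_in_span2_iff using pab zab by (metis to_ac_vec_add to_ac_vec_scale)+
  ultimately have "vec.span {to_ac_vec a, to_ac_vec b} = vec.span {to_ac_vec p, to_ac_vec z}"
    unfolding vec.span_eq by simp
  then show ?thesis unfolding ab(4) proj_line_def span_proj_points by simp
qed

section \<open>Hermitian cones\<close>

lemma rational_points_eq_image: "rational_points l = proj_point ` {z. z \<noteq> 0 \<and> proj_point z \<in> l}"
  by (auto simp: rational_points_def rational_point_iff)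

lemma combination_eq_iff:
  assumes "p \<noteq> 0" "\<forall>c. z \<noteq> c *s (p :: 'a::field ^ 'n::finite)"
  shows "a *s p + b *s z = a' *s p + b' *s z \<longleftrightarrow> a = a' \<and> b = b'"
proof
  assume "a *s p + b *s z = a' *s p + b' *s z"
  then have eq: "(b - b') *s z = (a' - a) *s p"
    by (simp add: vec.scale_left_diff_distrib algebra_simps)
  have zp: False if "c *s z = d *s p" "c \<noteq> 0" for c d
  proof -
    have "z = inverse c *s (c *s z)" using that(2) by simp
    also have "\<dots> = (inverse c * d) *s p" unfolding that(1) by (simp only: vector_smult_assoc)
    finally show False using assms(2) by blast
  qed
  have "b = b'" using zp[OF eq] by auto
  with eq assms(1) show "a = a' \<and> b = b'" by simp
qed auto

text \<open>Distinct lines share only the multiples of p, and each adds the vectors a p + b z with b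
  nonzero. As L is nonempty, the point of p is in the union and accounts for the summand 1.\<close>

lemma card_union_lines_through_point:
  fixes p :: "'a::{field,finite} ^ 'n::finite"
  assumes p: "p \<noteq> 0" and L: "finite L" "L \<noteq> {}" "\<And>l. l \<in> L \<Longrightarrow> rational_line l \<and> proj_point p \<in> l"
  shows "card (\<Union>l\<in>L. rational_points l) = 1 + CARD('a) * card L"
proof -
  define N where "N = (\<lambda>c. c *s p) ` (UNIV - {0})"
  define R where "R l = {z. (\<forall>c. z \<noteq> c *s p) \<and> proj_point z \<in> l}" for l :: "('a, 'n) point set"
  define Y where "Y = (\<Union>l\<in>L. {z. z \<noteq> 0 \<and> proj_point z \<in> l})"
  have Y: "Y = N \<union> (\<Union>l\<in>L. R l)"
  proof (intro equalityI subsetI)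
    fix z assume "z \<in> Y"
    then obtain l where l: "l \<in> L" "z \<noteq> 0" "proj_point z \<in> l" by (auto simp: Y_def)
    show "z \<in> N \<union> (\<Union>l\<in>L. R l)"
    proof (cases "\<exists>c. z = c *s p")
      case True
      then obtain c where "z = c *s p" ..
      with l(2) have "z \<in> N" by (auto simp: N_def)
      then show ?thesis ..
    next
      case False
      with l show ?thesis by (auto simp: R_def)
    qed
  next
    fix z assume z: "z \<in> N \<union> (\<Union>l\<in>L. R l)"
    show "z \<in> Y"
    proof (cases "z \<in> N")
      case True
      then obtain c where c: "c \<noteq> 0" "z = c *s p" by (auto simp: N_def)
      obtain l where "l \<in> L" using L(2) by blast
      with c p L(3)[of l] show ?thesis by (auto simp: Y_def proj_point_scale)
    next
      case False
      with z obtain l where l: "l \<in> L" "z \<in> R l" by blast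
      then have "z \<noteq> 0 *s p" "proj_point z \<in> l" unfolding R_def by blast+
      with l(1) show ?thesis by (auto simp: Y_def)
    qed
  qed
  have line: "l = proj_line (proj_point p) (proj_point z)" if "l \<in> L" "z \<in> R l" for l z
    using that L(3)[OF that(1)] p by (intro rational_line_eq_proj_line) (auto simp: R_def)
  have cR: "card (R l) = CARD('a) * (CARD('a) - 1)" if l: "l \<in> L" for l
  proof -
    obtain a b where ab: "a \<noteq> 0" "b \<noteq> 0" "proj_point a \<noteq> proj_point b"
      "l = proj_line (proj_point a) (proj_point b)"
      using L(3)[OF l] by (auto simp: rational_line_def rational_point_iff)
    have pts: "proj_point a \<in> l" "proj_point b \<in> l"
      using ab by (auto simp: proj_line_def proj_point_in_proj_space intro: vec.span_base)
    \<comment> \<open>A rational line has two distinct rational points, and they cannot both be the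
      point of p.\<close>
    have "\<exists>z. z \<in> R l"
    proof (rule ccontr)
      assume none: "\<nexists>z. z \<in> R l"
      with pts obtain c d where "a = c *s p" "b = d *s p" unfolding R_def by blast
      with ab(1,2) have "proj_point a = proj_point p" "proj_point b = proj_point p"
        using proj_point_scale[of c p] proj_point_scale[of d p] by auto
      with ab(3) show False by simp
    qed
    then obtain z where z: "z \<in> R l" ..
    then have z': "\<forall>c. z \<noteq> c *s p" by (simp add: R_def)
    have "R l = (\<lambda>(a, b). a *s p + b *s z) ` (UNIV \<times> (UNIV - {0}))"
    proof (intro equalityI subsetI)
      fix w assume w: "w \<in> R l"
      then have "w \<noteq> 0 *s p" "proj_point w \<in> l" unfolding R_def by blast+
      then obtain a b where ab: "w = a *s p + b *s z"
        using proj_point_in_proj_line[OF p z', of w] line[OF l z] by auto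
      have "b \<noteq> 0"
      proof
        assume "b = 0"
        with ab have "w = a *s p" by simp
        with w show False unfolding R_def by blast
      qed
      with ab show "w \<in> (\<lambda>(a, b). a *s p + b *s z) ` (UNIV \<times> (UNIV - {0}))" by auto
    next
      fix w assume "w \<in> (\<lambda>(a, b). a *s p + b *s z) ` (UNIV \<times> (UNIV - {0}))"
      then obtain a b where w: "w = a *s p + b *s z" "b \<noteq> 0" by auto
      have 1: "w \<noteq> c *s p" for c
        using combination_eq_iff[OF p z', of a b c 0] w by simp
      then have "w \<noteq> 0" using 1[of 0] by simp
      then have "proj_point w \<in> l"
        using proj_point_in_proj_line[OF p z', of w] line[OF l z] w(1) by blast
      with 1 show "w \<in> R l" by (simp add: R_def)
    qed
    moreover have "inj_on (\<lambda>(a, b). a *s p + b *s z) (UNIV \<times> (UNIV - {0}))"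
      using combination_eq_iff[OF p z'] by (auto simp: inj_on_def)
    ultimately have "card (R l) = card ((UNIV :: 'a set) \<times> (UNIV - {0::'a}))"
      by (simp only: card_image)
    then show ?thesis by (simp add: card_cartesian_product card_Diff_singleton)
  qed
  have "card Y = card N + card (\<Union>l\<in>L. R l)"
    unfolding Y by (rule card_Un_disjoint) (auto simp: N_def R_def)
  also have "card N = CARD('a) - 1"
    unfolding N_def using p by (subst card_image) (auto simp: inj_on_def card_Diff_singleton)
  also have "card (\<Union>l\<in>L. R l) = (\<Sum>l\<in>L. card (R l))"
  proof (rule card_UN_disjoint[OF L(1)])
    show "\<forall>l\<in>L. \<forall>l'\<in>L. l \<noteq> l' \<longrightarrow> R l \<inter> R l' = {}"
    proof (intro ballI impI equals0I)
      fix l l' z assume "l \<in> L" "l' \<in> L" "l \<noteq> l'" "z \<in> R l \<inter> R l'"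
      then show False using line[of l z] line[of l' z] by auto
    qed
  qed simp
  also have "\<dots> = card L * (CARD('a) * (CARD('a) - 1))" by (simp add: cR)
  finally have "card Y = (CARD('a) - 1) * (1 + CARD('a) * card L)"
    by (simp add: distrib_left mult_ac)
  moreover have "card Y = (CARD('a) - 1) * card (proj_point ` Y)"
    by (rule card_proj_points) (auto simp: Y_def proj_point_scale)
  moreover have "proj_point ` Y = (\<Union>l\<in>L. rational_points l)"
    by (auto simp: Y_def rational_points_eq_image)
  moreover have "CARD('a) - 1 > 0"
    using card_mono[of UNIV "{0, 1 :: 'a}"] by simp
  ultimately show ?thesis by (metis nat_mult_eq_cancel1)
qed

context square_field
begin

lemma cone_vertex_in_radical:
  fixes H :: "'a ^ 'n::finite ^ 'n"
  assumes H: "hermitian_matrix q H" and p: "p \<noteq> 0"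
    and V: "cone_vertex (hermitian_variety q H) (proj_point p)"
  shows "herm q H p y = 0"
proof (rule isotropic_vertex_in_radical[OF H])
  show pp: "herm q H p p = 0"
    using V p by (simp add: cone_vertex_def proj_point_in_hermitian_variety)
  fix x t assume x: "herm q H x x = 0"
  show "herm q H (x + t *s p) (x + t *s p) = 0"
  proof (cases "\<exists>c. x = c *s p")
    case True
    then show ?thesis
      by (auto simp: herm_add_left herm_add_right herm_scale_left herm_scale_right pp)
  next
    case False
    then have indep: "\<forall>c. x \<noteq> c *s p" by blast
    then have x0: "x \<noteq> 0" by (metis vec.scale_zero_left)
    have "x + t *s p \<noteq> 0" using indep[rule_format, of "- t"] by (simp add: eq_neg_iff_add_eq_0)
    moreover from this have "proj_point (x + t *s p) \<in> proj_line (proj_point p) (proj_point x)"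
      using proj_point_in_proj_line[OF p indep] by (metis add.commute vec.scale_one)
    moreover have "proj_line (proj_point p) (proj_point x) \<subseteq> hermitian_variety q H"
    proof -
      have "proj_point x \<noteq> proj_point p" using proj_point_eq_iff[OF p x0] indep by blast
      moreover have "proj_point x \<in> hermitian_variety q H"
        using x x0 by (simp add: proj_point_in_hermitian_variety)
      ultimately show ?thesis using V by (simp add: cone_vertex_def)
    qed
    ultimately show ?thesis using proj_point_in_hermitian_variety by blast
  qed
qed

end

context hermitian_surface
begin

lemma isotropic_scale: "x \<in> isotropic \<Longrightarrow> c \<noteq> 0 \<Longrightarrow> c *s x \<in> isotropic"
  by (simp add: isotropic_def herm_scale_left herm_scale_right)

lemma card_isotropic_zeros_le_M3:
  assumes g: "form d g" "g y \<noteq> 0"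
  shows "card {x \<in> isotropic. g x = 0} \<le> (q\<^sup>2 - 1) * M3 q U d"
proof -
  let ?pts = "\<lambda>G :: ('a, 4) mpoly. rational_points (hermitian_variety q U \<inter> zero_set G)"
  obtain G where G: "homogeneous d G" "rational_eval G = g"
    using form_imp_rational_eval[OF g(1)] by blast
  have "G \<noteq> 0" using g(2) unfolding G(2)[symmetric] by (auto simp: rational_eval_def)
  have "card {x \<in> isotropic. g x = 0} = (CARD('a) - 1) * card (proj_point ` {x \<in> isotropic. g x = 0})"
    by (rule card_proj_points) (auto simp: isotropic_scale form_homogeneous[OF g(1)], auto simp: isotropic_def)
  moreover have "?pts G = proj_point ` {x \<in> isotropic. g x = 0}"
    unfolding rational_points_hermitian_zero_set[OF G(1)] G(2)
    by (intro arg_cong2[where f = image]) (auto simp: isotropic_def)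
  moreover have "card (?pts G) \<le> M3 q U d"
    unfolding M3_def
  proof (rule Max_ge)
    have "card (?pts G) \<le> card (UNIV :: ('a ^ 4) set)" if "homogeneous d G" for G
    proof -
      have "?pts G \<subseteq> range proj_point" unfolding rational_points_hermitian_zero_set[OF that] by blast
      then have "card (?pts G) \<le> card (range (proj_point :: 'a ^ 4 \<Rightarrow> _))" by (intro card_mono) auto
      also have "\<dots> \<le> card (UNIV :: ('a ^ 4) set)" by (rule card_image_le) simp
      finally show ?thesis .
    qed
    then have "{card (?pts G) |G. G \<noteq> 0 \<and> homogeneous d G} \<subseteq> {..card (UNIV :: ('a ^ 4) set)}" by blast
    then show "finite {card (?pts G) |G. G \<noteq> 0 \<and> homogeneous d G}" by (rule finite_subset) simp
  qed (use \<open>G \<noteq> 0\<close> G(1) in blast)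
  ultimately show ?thesis by (simp add: card_field)
qed

lemma gain_M3:
  assumes g: "form e g" "g y \<noteq> 0" and k: "k \<ge> 1" "e + k \<le> q - 1"
  shows "q\<^sup>2 * card {x \<in> isotropic. g x = 0} + k * card {x \<in> isotropic. g x \<noteq> 0} <
    (q\<^sup>2 - 1) * (q\<^sup>2 * M3 q U (e + k))"
proof -
  obtain g' y' where "form (e + k) g'" "g' y' \<noteq> 0"
    and *: "q\<^sup>2 * card {x \<in> isotropic. g x = 0} + k * card {x \<in> isotropic. g x \<noteq> 0} <
      q\<^sup>2 * card {x \<in> isotropic. g' x = 0}"
    using gain[OF assms] by blast
  then have "card {x \<in> isotropic. g' x = 0} \<le> (q\<^sup>2 - 1) * M3 q U (e + k)"
    by (intro card_isotropic_zeros_le_M3)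
  then have "q\<^sup>2 * card {x \<in> isotropic. g' x = 0} \<le> q\<^sup>2 * ((q\<^sup>2 - 1) * M3 q U (e + k))"
    by (rule mult_le_mono2)
  with * show ?thesis by (simp only: mult.left_commute)
qed

text \<open>The constant form 1 with k = d in \<open>gain_M3\<close> bounds a multiple of
  \<open>M3 q U d\<close> strictly from below by a natural number.\<close>

lemma M3_pos:
  assumes "1 \<le> d" "d \<le> q - 1"
  shows "M3 q U d > 0"
proof (rule ccontr)
  assume "\<not> ?thesis"
  then show False
    using gain_M3[OF form.const[of 1], of d] assms by simp
qed

text \<open>A embeds \<open>U\<close> isometrically into \<open>H\<close>. Pairing with the image of
  A removes the part along p, so nondegeneracy of \<open>U\<close> gives injectivity; equal
  cardinalities then give bijectivity.\<close>

lemma cone_coordinates: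
  fixes H :: "'a ^ 5 ^ 5"
  assumes H: "hermitian_matrix q H" "rank H = 4" and p: "p \<noteq> 0" "\<And>y. herm q H p y = 0"
  shows "\<exists>A :: 'a ^ 4 ^ 5. bij (\<lambda>(u, t). A *v u + t *s p) \<and>
    (\<forall>u t. herm q H (A *v u + t *s p) (A *v u + t *s p) = h u u)"
proof -
  obtain A :: "'a ^ 4 ^ 5" where A: "\<And>x y. herm q H (A *v x) (A *v y) = h x y"
    using isometry[OF hermitian _ H(1)] full_rank H(2) by auto
  have p': "herm q H y p = 0" for y using herm_swap_zero[OF H(1) p(2)] .
  have "inj (\<lambda>(u, t). A *v u + t *s p)"
  proof (rule injI, clarify)
    fix u t u' t' assume eq: "A *v u + t *s p = A *v u' + t' *s p"
    have "h u y = h u' y" for y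
      using arg_cong[OF eq, of "\<lambda>z. herm q H z (A *v y)"]
      by (simp add: herm_add_left herm_scale_left p(2) A)
    then have "h (u - u') y = 0" for y
      using herm_add_left[of q U "u - u'" u' y] by simp
    then have "u = u'" using nondegenerate[of "u - u'"] by simp
    with eq p(1) show "u = u' \<and> t = t'" by simp
  qed
  moreover from this have "range (\<lambda>(u, t). A *v u + t *s p) = UNIV"
  proof (intro card_subset_eq)
    have "CARD(('a ^ 4) \<times> 'a) = CARD('a) ^ 4 * CARD('a)" by simp
    also have "\<dots> = CARD('a) ^ (4 + 1)" by (simp only: power_add power_one_right)
    also have "\<dots> = CARD('a ^ 5)" by simp
    finally show "card (range (\<lambda>(u, t). A *v u + t *s p)) = CARD('a ^ 5)"
      if "inj (\<lambda>(u, t). A *v u + t *s p)" using that by (simp only: card_image)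
  qed simp_all
  ultimately have "bij (\<lambda>(u, t). A *v u + t *s p)" by (simp add: bij_def)
  moreover have "herm q H (A *v u + t *s p) (A *v u + t *s p) = h u u" for u t
    by (simp add: herm_add_left herm_add_right herm_scale_left herm_scale_right p(2) p' A)
  ultimately show ?thesis by blast
qed

end

section \<open>The count on the cone\<close>

lemma sum_if_card:
  fixes a b :: nat
  assumes "finite I"
  shows "(\<Sum>x\<in>I. if Q x then a else b) = a * card {x \<in> I. Q x} + b * card {x \<in> I. \<not> Q x}"
  using assms by (simp add: sum.If_cases Int_def Collect_conj_eq [symmetric] mult.commute)

theorem theorem3p16:
  fixes q d :: nat
    and H :: "'a::{field,finite} ^ 5 ^ 5"
    and P :: "('a, 5) point"
    and F :: "('a, 5) mpoly"
    and U :: "'a ^ 4 ^ 4"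
  assumes "primepow q" and "CARD('a) = q\<^sup>2"
    and "hermitian_matrix q H" and "rank H = 4"
    and "rational_point P" and "cone_vertex (hermitian_variety q H) P"
    and "hermitian_matrix q U" and "rank U = 4"
    and "F \<noteq> 0" and "homogeneous d F" and "1 \<le> d" and "d \<le> q - 1"
  shows "card (rational_points (hermitian_variety q H \<inter> zero_set F)) = 1 + q\<^sup>2 * M3 q U d \<longleftrightarrow>
    (\<exists>L. finite L \<and> card L = M3 q U d \<and>
       (\<forall>l\<in>L. rational_line l \<and> l \<subseteq> hermitian_variety q H \<and> P \<in> l) \<and>
       rational_points (hermitian_variety q H \<inter> zero_set F) = (\<Union>l\<in>L. rational_points l))"
proof -
  interpret hermitian_surface q "TYPE('a)" U
    by unfold_locales (fact assms)+
  obtain p where p: "p \<noteq> 0" "P = proj_point p"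
    using assms(5) by (auto simp: rational_point_iff)
  have vertex: "cone_vertex (hermitian_variety q H) (proj_point p)" using assms(6) p(2) by simp
  have rad: "herm q H p y = 0" for y
    by (rule cone_vertex_in_radical[OF assms(3) p(1) vertex])
  from cone_coordinates[OF assms(3,4) p(1) rad]
  obtain A where bij: "bij (\<lambda>(u, t). A *v u + t *s p)"
    and hA: "\<forall>u t. herm q H (A *v u + t *s p) (A *v u + t *s p) = h u u" by blast
  have A_eq_iff: "A *v u + t *s p = A *v u' + t' *s p \<longleftrightarrow> u = u' \<and> t = t'" for u t u' t'
    using inj_eq[OF bij_is_inj[OF bij], of "(u, t)" "(u', t')"] by simp
  have coords: "\<exists>u t. z = A *v u + t *s p" for z
    using bij_is_surj[OF bij] by (metis (no_types, lifting) case_prod_conv surj_def surj_pair)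
  have M_pos: "M3 q U d > 0" using M3_pos assms(11,12) .
  have q_less: "q < q\<^sup>2" using q_ge_2 by (simp add: power2_eq_square)
  then have q2: "q\<^sup>2 - 1 > 0" "0 < q\<^sup>2" using q_ge_2 by simp_all
  define f where "f = rational_eval F"
  have f: "form d f" unfolding f_def by (rule form_rational_eval[OF assms(10)])
  define S where "S = {v. v \<noteq> 0 \<and> herm q H v v = 0 \<and> f v = 0}"
  have pts: "rational_points (hermitian_variety q H \<inter> zero_set F) = proj_point ` S"
    unfolding S_def f_def by (rule rational_points_hermitian_zero_set[OF assms(10)])
  have card_S: "card S = (q\<^sup>2 - 1) * card (proj_point ` S)"
    unfolding card_field[symmetric]
    by (rule card_proj_points) (auto simp: S_def herm_scale_left herm_scale_right form_homogeneous[OF f])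
  \<comment> \<open>The vectors are sorted by their base part u: u = 0 gives the multiples of the
    vertex, an isotropic u the part over one base vector.\<close>
  have card_S_coords: "card S = card {t. t \<noteq> 0 \<and> f (t *s p) = 0} +
    (\<Sum>u\<in>isotropic. card {t. f (A *v u + t *s p) = 0})"
  proof -
    let ?W0 = "{0} \<times> {t. t \<noteq> 0 \<and> f (t *s p) = 0} :: (('a ^ 4) \<times> 'a) set"
    let ?W1 = "SIGMA u:isotropic. {t. f (A *v u + t *s p) = 0}"
    have "S = (\<lambda>(u, t). A *v u + t *s p) ` (?W0 \<union> ?W1)"
    proof (intro equalityI subsetI)
      fix z assume z: "z \<in> S"
      obtain u t where ut: "z = A *v u + t *s p" using coords by blast
      have "h u u = 0" using z hA unfolding ut S_def by simp
      then have "(u, t) \<in> ?W0 \<union> ?W1"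
        using z unfolding ut S_def isotropic_def by (cases "u = 0") auto
      then show "z \<in> (\<lambda>(u, t). A *v u + t *s p) ` (?W0 \<union> ?W1)"
        unfolding ut by (rule rev_image_eqI) simp
    next
      fix z assume "z \<in> (\<lambda>(u, t). A *v u + t *s p) ` (?W0 \<union> ?W1)"
      then obtain u t where ut: "z = A *v u + t *s p" "(u, t) \<in> ?W0 \<union> ?W1" by auto
      have "z \<noteq> 0" using A_eq_iff[of u t 0 0] ut by (auto simp: isotropic_def)
      moreover have "h u u = 0" using ut(2) by (auto simp: isotropic_def)
      ultimately show "z \<in> S" using ut hA by (auto simp: S_def)
    qed
    moreover have "inj_on (\<lambda>(u, t). A *v u + t *s p) (?W0 \<union> ?W1)"
      by (rule inj_on_subset[OF bij_is_inj[OF bij] subset_UNIV])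
    ultimately have "card S = card (?W0 \<union> ?W1)" by (simp only: card_image)
    also have "\<dots> = card ?W0 + card ?W1"
      by (rule card_Un_disjoint) (auto simp: isotropic_def)
    finally show ?thesis by (simp add: card_cartesian_product)
  qed
  obtain g where g: "\<forall>j\<le>d. form (d - j) (g j)" "\<forall>u t. f (A *v u + t *s p) = (\<Sum>j\<le>d. t ^ j * g j u)"
    using form_expand[OF f, of A p] by blast
  define J where "J = {j. j \<le> d \<and> (\<exists>u. g j u \<noteq> 0)}"
  have "J \<noteq> {}"
  proof
    assume "J = {}"
    then have "f (A *v u + t *s p) = 0" for u t unfolding g(2)[rule_format] J_def by auto
    then have "f z = 0" for z using coords[of z] by auto
    moreover have "d < CARD('a)"
      using assms(12) q_less by (simp add: card_field)
    ultimately show False using rational_eval_nonzero[OF assms(9,10)] by (simp add: f_def)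
  qed
  define k where "k = Max J"
  have finJ: "finite J" by (simp add: J_def)
  have "k \<in> J" unfolding k_def using finJ \<open>J \<noteq> {}\<close> by (rule Max_in)
  then obtain y where k: "k \<le> d" "g k y \<noteq> 0" by (auto simp: J_def)
  have top: "g j u = 0" if "j \<le> d" "k < j" for j u
    using Max_ge[OF finJ, of j] that unfolding k_def[symmetric] by (auto simp: J_def)
  have fk: "f (A *v u + t *s p) = (\<Sum>j\<le>k. t ^ j * g j u)" for u t
    unfolding g(2)[rule_format] using k(1) top by (intro sum.mono_neutral_right) auto
  have gk: "form (d - k) (g k)" using g(1) k(1) by blast
  show ?thesis
  proof
    assume "\<exists>L. finite L \<and> card L = M3 q U d \<and>
       (\<forall>l\<in>L. rational_line l \<and> l \<subseteq> hermitian_variety q H \<and> P \<in> l) \<and>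
       rational_points (hermitian_variety q H \<inter> zero_set F) = (\<Union>l\<in>L. rational_points l)"
    then obtain L where L: "finite L" "card L = M3 q U d"
      "\<forall>l\<in>L. rational_line l \<and> l \<subseteq> hermitian_variety q H \<and> P \<in> l"
      "rational_points (hermitian_variety q H \<inter> zero_set F) = (\<Union>l\<in>L. rational_points l)" by blast
    \<comment> \<open>Without a line the vertex would be missing from the union, and with it the
      summand 1.\<close>
    have "L \<noteq> {}" using L(2) M_pos by auto
    then show "card (rational_points (hermitian_variety q H \<inter> zero_set F)) = 1 + q\<^sup>2 * M3 q U d"
      unfolding L(4) using card_union_lines_through_point[OF p(1) L(1)] L(2,3) p(2) by (simp add: card_field)
  next
    assume "card (rational_points (hermitian_variety q H \<inter> zero_set F)) = 1 + q\<^sup>2 * M3 q U d"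
    then have eq: "card S = (q\<^sup>2 - 1) * (1 + q\<^sup>2 * M3 q U d)" unfolding card_S pts by simp
    have k0: "k = 0"
    proof (rule ccontr)
      assume "k \<noteq> 0"
      have "card {t. f (A *v u + t *s p) = 0} \<le> (if g k u = 0 then q\<^sup>2 else k)" for u
      proof (cases "g k u = 0")
        case True
        have "card {t. f (A *v u + t *s p) = 0} \<le> card (UNIV :: 'a set)" by (rule card_mono) auto
        with True show ?thesis by (simp add: card_field)
      next
        case False
        let ?p = "\<Sum>j\<le>k. Polynomial.monom (g j u) j"
        have "?p \<noteq> 0" using coeff_sum_monom[of k k "\<lambda>j. g j u"] False by (metis coeff_0 le_refl)
        from poly_roots_card_le[OF this degree_sum_monom] False show ?thesis
          by (simp add: poly_sum_monom fk)
      qed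
      then have "(\<Sum>u\<in>isotropic. card {t. f (A *v u + t *s p) = 0}) \<le>
          (\<Sum>u\<in>isotropic. if g k u = 0 then q\<^sup>2 else k)" by (rule sum_mono)
      also have "\<dots> = q\<^sup>2 * card {u \<in> isotropic. g k u = 0} + k * card {u \<in> isotropic. g k u \<noteq> 0}"
        by (rule sum_if_card) simp
      also have "\<dots> < (q\<^sup>2 - 1) * (q\<^sup>2 * M3 q U (d - k + k))"
        using \<open>k \<noteq> 0\<close> k assms(12) by (intro gain_M3[OF gk k(2)]) auto
      also have "d - k + k = d" using k(1) by simp
      finally have "(\<Sum>u\<in>isotropic. card {t. f (A *v u + t *s p) = 0}) < (q\<^sup>2 - 1) * (q\<^sup>2 * M3 q U d)" .
      \<comment> \<open>The vertex accounts for at most q^2 - 1 vectors, exactly the summand 1 of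
        the expected count times the representatives of a point; the strict deficit elsewhere
        therefore survives.\<close>
      moreover have "card {t. t \<noteq> 0 \<and> f (t *s p) = 0} \<le> card (UNIV - {0 :: 'a})" by (rule card_mono) auto
      then have "card {t. t \<noteq> 0 \<and> f (t *s p) = 0} \<le> q\<^sup>2 - 1" by (simp add: card_Diff_singleton card_field)
      ultimately show False using eq unfolding card_S_coords distrib_left by linarith
    qed
    \<comment> \<open>The value no longer depends on t: over the base field, membership in V(F) is
      decided by the base part alone.\<close>
    have fg: "f (A *v u + t *s p) = g 0 u" for u t by (simp add: fk k0)
    have g0: "form d (g 0)" using gk k0 by simp
    \<comment> \<open>As d >= 1, the form vanishes at the origin, which puts the vertex on
      V(F).\<close>
    have "g 0 0 = 0" using form_homogeneous[OF g0, of 0 0] assms(11) by (simp add: power_0_left)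
    then have fp: "f (t *s p) = 0" for t using fg[of 0 t] by simp
    define Z where "Z = {u \<in> isotropic. g 0 u = 0}"
    have "{t. t \<noteq> 0 \<and> f (t *s p) = 0} = UNIV - {0}" using fp by auto
    then have "card {t. t \<noteq> 0 \<and> f (t *s p) = 0} = q\<^sup>2 - 1" by (simp add: card_Diff_singleton card_field)
    moreover have "(\<Sum>u\<in>isotropic. card {t. f (A *v u + t *s p) = 0}) = (\<Sum>u\<in>isotropic. if g 0 u = 0 then q\<^sup>2 else 0)"
      by (intro sum.cong) (auto simp: fg card_field)
    then have "(\<Sum>u\<in>isotropic. card {t. f (A *v u + t *s p) = 0}) = q\<^sup>2 * card Z"
      unfolding Z_def by (simp only: sum_if_card finite mult_0 add_0_right)
    ultimately have "(q\<^sup>2 - 1) + q\<^sup>2 * card Z = (q\<^sup>2 - 1) * (1 + q\<^sup>2 * M3 q U d)"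
      using eq card_S_coords by simp
    then have "q\<^sup>2 * card Z = q\<^sup>2 * ((q\<^sup>2 - 1) * M3 q U d)"
      by (simp only: distrib_left mult.left_commute mult_1_right add_left_cancel)
    then have card_Z: "card Z = (q\<^sup>2 - 1) * M3 q U d" using q2(2) by (simp only: nat_mult_eq_cancel1)
    have Z_scale: "c *s u \<in> Z" if "u \<in> Z" "c \<noteq> 0" for c u
      using that by (simp add: Z_def isotropic_scale form_homogeneous[OF g0])
    have indep: "\<forall>c. A *v u \<noteq> c *s p" and Au0: "A *v u \<noteq> 0" if "u \<in> Z" for u
      using A_eq_iff[of u 0 0] that by (auto simp: Z_def isotropic_def)
    define line where "line u = proj_line (proj_point p) (proj_point (A *v u))" for u
    have mem_line: "proj_point z \<in> line u \<longleftrightarrow> (\<exists>a b. z = a *s p + b *s (A *v u))" if "u \<in> Z" "z \<noteq> 0" for u z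
      unfolding line_def by (rule proj_point_in_proj_line[OF p(1) indep[OF that(1)] that(2)])
    define L where "L = line ` Z"
    \<comment> \<open>Base vectors give the same line exactly if they are nonzero multiples of each
      other.\<close>
    have "card Z = (q\<^sup>2 - 1) * card L"
      unfolding L_def
    proof (rule card_fibres_eq)
      fix l assume "l \<in> line ` Z"
      then obtain u where u: "u \<in> Z" "l = line u" by blast
      have "{x \<in> Z. line x = l} = (\<lambda>c. c *s u) ` (UNIV - {0})"
      proof (intro equalityI subsetI)
        fix x assume "x \<in> {x \<in> Z. line x = l}"
        then have x: "x \<in> Z" "line x = line u" by (simp_all add: u(2))
        \<comment> \<open>The point of \<open>A *v x\<close> lies on the line of u; uniqueness of
          coordinates removes the vertex part and leaves x as a multiple of u.\<close>
        have "proj_point (A *v x) \<in> line x"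
          unfolding mem_line[OF x(1) Au0[OF x(1)]] by (intro exI[of _ 0] exI[of _ 1]) simp
        then obtain a b where "A *v x = a *s p + b *s (A *v u)"
          unfolding x(2) mem_line[OF u(1) Au0[OF x(1)]] by blast
        then have "A *v x + 0 *s p = A *v (b *s u) + a *s p" by (simp add: vector_scalar_commute add.commute)
        then have xb: "x = b *s u" unfolding A_eq_iff by simp
        moreover have "b \<noteq> 0" using x(1) xb by (auto simp: Z_def isotropic_def)
        ultimately show "x \<in> (\<lambda>c. c *s u) ` (UNIV - {0})" by blast
      next
        fix x assume "x \<in> (\<lambda>c. c *s u) ` (UNIV - {0})"
        then obtain c where c: "c \<noteq> 0" "x = c *s u" by blast
        then have "proj_point (A *v x) = proj_point (A *v u)"
          by (simp add: vector_scalar_commute proj_point_scale)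
        with c Z_scale[OF u(1)] show "x \<in> {x \<in> Z. line x = l}" by (simp add: u(2) line_def)
      qed
      moreover have "u \<noteq> 0" using u(1) by (simp add: Z_def isotropic_def)
      then have "inj_on (\<lambda>c. c *s u) (UNIV - {0})" by (auto simp: inj_on_def)
      ultimately have "card {x \<in> Z. line x = l} = card (UNIV - {0 :: 'a})" by (simp only: card_image)
      then show "card {x \<in> Z. line x = l} = q\<^sup>2 - 1" by (simp add: card_Diff_singleton card_field)
    qed simp
    with card_Z q2(1) have card_L: "card L = M3 q U d" by simp
    have "rational_line l \<and> l \<subseteq> hermitian_variety q H \<and> P \<in> l" if l: "l \<in> L" for l
    proof -
      obtain u where u: "u \<in> Z" "l = line u" using l by (auto simp: L_def)
      have ne: "proj_point (A *v u) \<noteq> proj_point p"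
        using indep[OF u(1)] unfolding proj_point_eq_iff[OF p(1) Au0[OF u(1)]] by blast
      have "rational_line l"
        unfolding rational_line_def u(2) line_def using ne p(1) Au0[OF u(1)] by (metis rational_point_iff)
      moreover have "herm q H (A *v u) (A *v u) = 0"
        using hA[rule_format, of u 0] u(1) by (simp add: Z_def isotropic_def)
      then have "proj_point (A *v u) \<in> hermitian_variety q H"
        using Au0[OF u(1)] by (simp add: proj_point_in_hermitian_variety)
      then have "l \<subseteq> hermitian_variety q H"
        using vertex ne unfolding cone_vertex_def u(2) line_def by blast
      moreover have "proj_point p \<in> l"
        unfolding u(2) mem_line[OF u(1) p(1)] by (intro exI[of _ 1] exI[of _ 0]) simp
      ultimately show ?thesis by (simp add: p(2))
    qed
    moreover have "proj_point ` S = (\<Union>l\<in>L. rational_points l)"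
    proof (intro equalityI subsetI)
      fix R assume "R \<in> proj_point ` S"
      then obtain z where z: "z \<in> S" "R = proj_point z" by blast
      then have z0: "z \<noteq> 0" by (simp add: S_def)
      obtain u t where ut: "z = A *v u + t *s p" using coords by blast
      have "\<exists>u\<in>Z. R \<in> line u"
      proof (cases "u = 0")
        case True
        \<comment> \<open>Here z is a multiple of the vertex vector and lies on every line, so any
          element of \<open>Z\<close> serves; positivity of \<open>M3 q U d\<close> provides
          one.\<close>
        have "card Z > 0" using card_Z M_pos q2(1) by simp
        then obtain u' where u': "u' \<in> Z" by (auto simp: card_gt_0_iff)
        have "z = t *s p + 0 *s (A *v u')" by (simp add: ut True)
        then have "R \<in> line u'" unfolding z(2) mem_line[OF u' z0] by blast
        with u' show ?thesis by blast
      next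
        case False
        then have u: "u \<in> Z" using z(1) hA fg unfolding ut S_def by (simp add: Z_def isotropic_def)
        have "z = t *s p + 1 *s (A *v u)" by (simp add: ut add.commute)
        then have "R \<in> line u" unfolding z(2) mem_line[OF u z0] by blast
        with u show ?thesis by blast
      qed
      then show "R \<in> (\<Union>l\<in>L. rational_points l)"
        using z(2) z0 by (auto simp: L_def rational_points_def rational_point_iff)
    next
      fix R assume "R \<in> (\<Union>l\<in>L. rational_points l)"
      then obtain u w where u: "u \<in> Z" and w: "w \<noteq> 0" "R = proj_point w" "proj_point w \<in> line u"
        by (auto simp: L_def rational_points_eq_image)
      obtain a b where "w = a *s p + b *s (A *v u)" using w(3) unfolding mem_line[OF u w(1)] by blast
      then have w_eq: "w = A *v (b *s u) + a *s p" by (simp add: vector_scalar_commute add.commute)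
      have "herm q H w w = 0" "f w = 0"
        using hA u unfolding w_eq by (simp_all add: fg form_homogeneous[OF g0] Z_def isotropic_def
          herm_scale_left herm_scale_right)
      with w show "R \<in> proj_point ` S" by (auto simp: S_def)
    qed
    ultimately show "\<exists>L. finite L \<and> card L = M3 q U d \<and>
       (\<forall>l\<in>L. rational_line l \<and> l \<subseteq> hermitian_variety q H \<and> P \<in> l) \<and>
       rational_points (hermitian_variety q H \<inter> zero_set F) = (\<Union>l\<in>L. rational_points l)"
      unfolding pts using card_L by (intro exI[of _ L]) (simp add: L_def)
  qed
qed

end
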